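(* Let $\Gamma$ be a finite, simple, connected $3$-valent graph and let $G\le \mathrm{Aut}(\Gamma)$ be a group acting transitively on the edge-set $\mathrm{E}(\Gamma)$. Then $G$ contains a semiregular element, that is, a non-identity element $g$ such that the cyclic group $\langle g\rangle$ acts semiregularly on the vertex-set $\mathrm{V}(\Gamma)$ (every vertex has trivial stabiliser in $\langle g\rangle$; equivalently, all cycles of $g$ on $\mathrm{V}(\Gamma)$ have the same length).
   Context: All graphs are finite and simple. A graph $\Gamma$ is $G$-edge-transitive if $G\le\mathrm{Aut}(\Gamma)$ acts transitively on $\mathrm{E}(\Gamma)$. A group acting on a set is semiregular if all point stabilisers are trivial. *)

theory Defs
  imports "HOL-Algebra.Algebra"
begin

definition simple_graph :: "'a set \<Rightarrow> ('a \<Rightarrow> 'a \<Rightarrow> bool) \<Rightarrow> bool" where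
  "simple_graph V E \<longleftrightarrow> finite V \<and> (\<forall>x y. E x y \<longrightarrow> x \<in> V \<and> y \<in> V) \<and>
     (\<forall>x y. E x y \<longrightarrow> E y x) \<and> (\<forall>x. \<not> E x x)"

definition connected_graph :: "'a set \<Rightarrow> ('a \<Rightarrow> 'a \<Rightarrow> bool) \<Rightarrow> bool" where
  "connected_graph V E \<longleftrightarrow> V \<noteq> {} \<and> (\<forall>u\<in>V. \<forall>v\<in>V. E\<^sup>*\<^sup>* u v)"

definition cubic :: "'a set \<Rightarrow> ('a \<Rightarrow> 'a \<Rightarrow> bool) \<Rightarrow> bool" where
  "cubic V E \<longleftrightarrow> (\<forall>v\<in>V. card {w. E v w} = 3)"

definition graph_aut :: "'a set \<Rightarrow> ('a \<Rightarrow> 'a \<Rightarrow> bool) \<Rightarrow> ('a \<Rightarrow> 'a) set" where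
  "graph_aut V E = {g \<in> Bij V. \<forall>x\<in>V. \<forall>y\<in>V. E x y \<longleftrightarrow> E (g x) (g y)}"

definition edge_transitive :: "('a \<Rightarrow> 'a \<Rightarrow> bool) \<Rightarrow> ('a \<Rightarrow> 'a) set \<Rightarrow> bool" where
  "edge_transitive E G \<longleftrightarrow>
     (\<forall>u v x y. E u v \<longrightarrow> E x y \<longrightarrow> (\<exists>g\<in>G. {g u, g v} = {x, y}))"

definition semiregular_element :: "'a set \<Rightarrow> ('a \<Rightarrow> 'a) \<Rightarrow> bool" where
  "semiregular_element V g \<longleftrightarrow>
     g \<noteq> \<one>\<^bsub>BijGroup V\<^esub> \<and>
     (\<forall>k::int. \<forall>v\<in>V. (g [^]\<^bsub>BijGroup V\<^esub> k) v = v \<longrightarrow> g [^]\<^bsub>BijGroup V\<^esub> k = \<one>\<^bsub>BijGroup V\<^esub>)"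

end

theory Submission
  imports Defs "Jordan_Normal_Form.Schur_Decomposition"
begin

text \<open>
  An automorphism of prime order \<open>p > 3\<close> that fixes a vertex fixes its three neighbours and hence,
  by connectedness, everything; so one may assume \<open>|G| = 2\<^sup>a 3\<^sup>b\<close>. By Burnside's theorem \<open>G\<close> then
  has a nontrivial normal subgroup \<open>N\<close> that is a 2-group or a 3-group. Vertex stabilisers in \<open>G\<close>
  are transitive on neighbours. If \<open>N\<close> is a 2-group, then \<open>N\<^sub>v\<close> fixes one of the three neighbours
  of \<open>v\<close>, hence all of them, and \<open>N\<close> is semiregular. If \<open>N\<close> is a 3-group, it may be replaced by an
  elementary abelian one, whose nontrivial vertex stabilisers have order 3; either \<open>N\<close> contains a
  fixed-point-free element or the graph is the complete bipartite graph on 3 + 3 vertices, where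
  one is written down.

  Burnside's theorem for the primes 2 and 3 needs no representation theory. In a simple group \<open>G\<close> of
  order \<open>2\<^sup>a 3\<^sup>b\<close> some class \<open>C\<close> of involutions has odd size, hence size \<open>q = 3\<^sup>c\<close>. Let the class sum
  of \<open>C\<close> act on the functions on \<open>G\<close> with mean value 0, let \<open>l \<noteq> 0\<close> be an eigenvalue and \<open>n\<close> its
  multiplicity. For \<open>t \<in> C\<close> the involutions \<open>x \<mapsto> tx\<close> and \<open>x \<mapsto> txt\<close> have integral traces
  \<open>n l / q\<close> and \<open>n l\<^sup>2 / q\<^sup>2\<close> on the eigenspace. Hence \<open>l\<close> is a rational algebraic integer, and
  \<open>|l| < q\<close> by simplicity, which together force 3 to divide \<open>n l / q\<close>. But these numbers sum to \<open>-1\<close>,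
  since left multiplication by \<open>t\<close> has trace 0 on all functions and trace 1 on the constants.
\<close>

section \<open>Eigenvalues of kernels on finite sets\<close>

definition mat_trace :: "'a :: comm_monoid_add mat \<Rightarrow> 'a" where
  "mat_trace A = (\<Sum>i<dim_row A. A $$ (i, i))"

lemma mat_trace_mult_commute:
  fixes A B :: "'a :: comm_semiring_0 mat"
  assumes "A \<in> carrier_mat n m" "B \<in> carrier_mat m n"
  shows "mat_trace (A * B) = mat_trace (B * A)"
proof -
  have "mat_trace (A * B) = (\<Sum>i<n. \<Sum>k<m. A $$ (i, k) * B $$ (k, i))"
    using assms by (auto simp: mat_trace_def scalar_prod_def atLeast0LessThan intro!: sum.cong)
  also have "\<dots> = (\<Sum>k<m. \<Sum>i<n. B $$ (k, i) * A $$ (i, k))"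
    by (subst sum.swap) (simp add: mult.commute)
  also have "\<dots> = mat_trace (B * A)"
    using assms by (auto simp: mat_trace_def scalar_prod_def atLeast0LessThan intro!: sum.cong)
  finally show ?thesis .
qed

lemma upper_triangular_mult:
  fixes A B :: "'a :: semiring_0 mat"
  assumes A: "A \<in> carrier_mat n n" "upper_triangular A"
    and B: "B \<in> carrier_mat n n" "upper_triangular B"
  shows "upper_triangular (A * B)"
    and "i < n \<Longrightarrow> (A * B) $$ (i, i) = A $$ (i, i) * B $$ (i, i)"
proof -
  have entry: "(A * B) $$ (i, j) = (\<Sum>k<n. A $$ (i, k) * B $$ (k, j))" if "i < n" "j < n" for i j
    using assms that by (auto simp: scalar_prod_def atLeast0LessThan)
  show "upper_triangular (A * B)"
  proof
    fix i j assume "j < i" "i < dim_row (A * B)"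
    moreover have "A $$ (i, k) * B $$ (k, j) = 0" if "k < n" "i < n" "j < i" for k
    proof (cases "k < i")
      case True
      then show ?thesis using upper_triangularD[OF A(2), of k i] A that by simp
    next
      case False
      then show ?thesis using upper_triangularD[OF B(2), of j k] B that by simp
    qed
    ultimately show "(A * B) $$ (i, j) = 0"
      using A(1) by (subst entry) (auto intro!: sum.neutral)
  qed
  show "(A * B) $$ (i, i) = A $$ (i, i) * B $$ (i, i)" if i: "i < n"
  proof -
    have "A $$ (i, k) * B $$ (k, i) = 0" if "k < n" "k \<noteq> i" for k
    proof (cases "k < i")
      case True
      then show ?thesis using upper_triangularD[OF A(2), of k i] A i by simp
    next
      case False
      then show ?thesis using upper_triangularD[OF B(2), of i k] B that by simp
    qed
    then have "(\<Sum>k<n. A $$ (i, k) * B $$ (k, i)) = (\<Sum>k\<in>{i}. A $$ (i, k) * B $$ (k, i))"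
      using i by (intro sum.mono_neutral_right) auto
    then show ?thesis using entry[OF i i] by simp
  qed
qed

lemma upper_triangular_pow:
  fixes B :: "'a :: comm_semiring_1 mat"
  assumes B: "B \<in> carrier_mat n n" "upper_triangular B"
  shows "upper_triangular (B ^\<^sub>m k) \<and> (\<forall>i<n. (B ^\<^sub>m k) $$ (i, i) = (B $$ (i, i)) ^ k)"
proof (induction k)
  case 0
  then show ?case using B by (auto simp: upper_triangular_def)
next
  case (Suc k)
  then show ?case
    using upper_triangular_mult[of "B ^\<^sub>m k" n B] B by (auto simp: mult.commute)
qed

text \<open>By Schur triangularisation \<open>A\<close> is similar to an upper triangular
  \<open>B\<close>. Traces of powers survive conjugation, and the diagonal of \<open>B\<close>,
  taken as \<open>ls\<close>, lists the eigenvalues with algebraic multiplicity.\<close>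

lemma mat_trace_pow_eq_power_sum:
  fixes A :: "complex mat"
  assumes A: "A \<in> carrier_mat n n"
  obtains ls where "\<And>k. mat_trace (A ^\<^sub>m k) = (\<Sum>l\<leftarrow>ls. l ^ k)"
    and "\<And>l. l \<in> set ls \<Longrightarrow> eigenvalue A l"
proof -
  obtain as where as: "char_poly A = (\<Prod>a\<leftarrow>as. [:- a, 1:])"
    using char_poly_factorized[OF A] by blast
  obtain B where B: "B \<in> carrier_mat n n" "upper_triangular B" "similar_mat A B"
    using schur_decomposition_exists[OF A as] by blast
  obtain P Q where wit: "similar_mat_wit A B P Q"
    using B(3) unfolding similar_mat_def by blast
  note PQ = similar_mat_witD2[OF A wit]
  have "mat_trace (A ^\<^sub>m k) = (\<Sum>l\<leftarrow>diag_mat B. l ^ k)" for k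
  proof -
    have Bk: "B ^\<^sub>m k \<in> carrier_mat n n" using B(1) by simp
    have "mat_trace (A ^\<^sub>m k) = mat_trace ((P * B ^\<^sub>m k) * Q)"
      using similar_mat_wit_pow_id[OF wit, of k] by simp
    also have "\<dots> = mat_trace (Q * (P * B ^\<^sub>m k))"
      using PQ Bk by (intro mat_trace_mult_commute[of _ n n]) auto
    also have "Q * (P * B ^\<^sub>m k) = B ^\<^sub>m k"
      using PQ Bk by (subst assoc_mult_mat[symmetric, of _ n n _ n _ n]) auto
    also have "mat_trace (B ^\<^sub>m k) = (\<Sum>i<n. (B $$ (i, i)) ^ k)"
      using upper_triangular_pow[OF B(1,2), of k] Bk B(1) by (auto simp: mat_trace_def)
    also have "\<dots> = (\<Sum>l\<leftarrow>diag_mat B. l ^ k)"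
      using B(1) by (simp add: diag_mat_def sum_list_sum_nth atLeast0LessThan)
    finally show ?thesis .
  qed
  moreover have "eigenvalue A l" if "l \<in> set (diag_mat B)" for l
  proof -
    have "char_poly A = (\<Prod>a\<leftarrow>diag_mat B. [:- a, 1:])"
      using char_poly_similar[OF B(3)] char_poly_upper_triangular[OF B(1,2)] by simp
    then have "poly (char_poly A) l = 0"
      using that by (simp add: poly_prod_list prod_list_zero_iff)
    then show ?thesis using eigenvalue_root_char_poly[OF A] by simp
  qed
  ultimately show ?thesis using that by blast
qed

section \<open>Powers and spectra of kernels\<close>

text \<open>Kernels are indexed by the set itself, so that translations of a group act on them
  without an enumeration. The index is shifted: stage \<open>j\<close> is the matrix power
  \<open>j + 1\<close>. No identity kernel occurs, and the power sums below have positive exponents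
  and do not see the eigenvalue 0.\<close>

primrec kernel_pow :: "'x set \<Rightarrow> ('x \<Rightarrow> 'x \<Rightarrow> complex) \<Rightarrow> nat \<Rightarrow> 'x \<Rightarrow> 'x \<Rightarrow> complex" where
  "kernel_pow D F 0 = F"
| "kernel_pow D F (Suc j) = (\<lambda>x y. \<Sum>z\<in>D. kernel_pow D F j x z * F z y)"

definition kernel_eigenvalue :: "'x set \<Rightarrow> ('x \<Rightarrow> 'x \<Rightarrow> complex) \<Rightarrow> complex \<Rightarrow> bool" where
  "kernel_eigenvalue D F l \<longleftrightarrow>
     (\<exists>v. (\<exists>x\<in>D. v x \<noteq> 0) \<and> (\<forall>x\<in>D. (\<Sum>y\<in>D. F x y * v y) = l * v x))"

lemma kernel_eigenvalue_iff:
  assumes e: "bij_betw e {0..<n} D" and A: "A = mat n n (\<lambda>(i, j). F (e i) (e j))"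
  shows "eigenvalue A l \<longleftrightarrow> kernel_eigenvalue D F l"
proof
  have reindex: "(\<Sum>y\<in>D. g y) = (\<Sum>j=0..<n. g (e j))" for g :: "'a \<Rightarrow> complex"
    by (rule sum.reindex_bij_betw[OF e, symmetric])
  have inj: "inj_on e {0..<n}" and im: "e ` {0..<n} = D"
    using e by (auto simp: bij_betw_def)
  {
    assume "eigenvalue A l"
    then obtain v where v: "v \<in> carrier_vec n" "v \<noteq> 0\<^sub>v n" "A *\<^sub>v v = l \<cdot>\<^sub>v v"
      by (auto simp: eigenvalue_def eigenvector_def A)
    define w where "w x = v $ (the_inv_into {0..<n} e x)" for x
    have w: "w (e i) = v $ i" if "i < n" for i
      using the_inv_into_f_f[OF inj, of i] that by (simp add: w_def)
    obtain i where i: "i < n" "v $ i \<noteq> 0"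
      using v(1,2) by (auto simp: vec_eq_iff)
    have "(\<Sum>y\<in>D. F (e i) y * w y) = l * w (e i)" if "i < n" for i
    proof -
      have "(\<Sum>y\<in>D. F (e i) y * w y) = (A *\<^sub>v v) $ i"
        using that v(1) by (simp add: reindex A scalar_prod_def w)
      then show ?thesis using that v(1,3) w by simp
    qed
    then have "(\<Sum>y\<in>D. F x y * w y) = l * w x" if "x \<in> D" for x
      using that im by auto
    moreover have "e i \<in> D" "w (e i) \<noteq> 0" using i w im by auto
    ultimately show "kernel_eigenvalue D F l"
      unfolding kernel_eigenvalue_def by blast
  next
    assume "kernel_eigenvalue D F l"
    then obtain w x where w: "x \<in> D" "w x \<noteq> 0" "\<And>x. x \<in> D \<Longrightarrow> (\<Sum>y\<in>D. F x y * w y) = l * w x"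
      unfolding kernel_eigenvalue_def by blast
    define v where "v = vec n (\<lambda>i. w (e i))"
    obtain i where i: "i < n" "x = e i" using w(1) im by auto
    have "v \<noteq> 0\<^sub>v n" using i w(2) by (auto simp: v_def vec_eq_iff)
    moreover have "A *\<^sub>v v = l \<cdot>\<^sub>v v"
    proof (rule eq_vecI)
      fix i assume "i < dim_vec (l \<cdot>\<^sub>v v)"
      then have i: "i < n" by (simp add: v_def)
      then have "e i \<in> D" using im by auto
      from w(3)[OF this] show "(A *\<^sub>v v) $ i = (l \<cdot>\<^sub>v v) $ i"
        using i by (simp add: A v_def scalar_prod_def reindex)
    qed (simp add: A v_def)
    ultimately show "eigenvalue A l"
      unfolding eigenvalue_def eigenvector_def by (intro exI[of _ v]) (auto simp: A v_def)
  }
qed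

lemma kernel_spectrum:
  fixes F :: "'x \<Rightarrow> 'x \<Rightarrow> complex"
  assumes D: "finite D"
  obtains ls where "\<And>j. (\<Sum>x\<in>D. kernel_pow D F j x x) = (\<Sum>l\<leftarrow>ls. l ^ Suc j)"
    and "\<And>l. l \<in> set ls \<Longrightarrow> kernel_eigenvalue D F l"
proof -
  define n where "n = card D"
  obtain e where e: "bij_betw e {0..<n} D"
    using ex_bij_betw_nat_finite[OF D] unfolding n_def by blast
  have reindex: "(\<Sum>y\<in>D. g y) = (\<Sum>j=0..<n. g (e j))" for g :: "'x \<Rightarrow> complex"
    by (rule sum.reindex_bij_betw[OF e, symmetric])
  define A where "A = mat n n (\<lambda>(i, j). F (e i) (e j))"
  have A: "A \<in> carrier_mat n n" by (simp add: A_def)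
  obtain ls where ls: "\<And>k. mat_trace (A ^\<^sub>m k) = (\<Sum>l\<leftarrow>ls. l ^ k)"
      "\<And>l. l \<in> set ls \<Longrightarrow> eigenvalue A l"
    using mat_trace_pow_eq_power_sum[OF A] by blast
  have pow: "A ^\<^sub>m Suc k = mat n n (\<lambda>(i, j). kernel_pow D F k (e i) (e j))" for k
  proof (induction k)
    case 0
    show ?case by (simp add: A_def)
  next
    case (Suc k)
    have "A ^\<^sub>m Suc (Suc k) = A ^\<^sub>m Suc k * A" by simp
    also have "\<dots> = mat n n (\<lambda>(i, j). kernel_pow D F (Suc k) (e i) (e j))"
      unfolding Suc by (rule eq_matI) (auto simp: A_def scalar_prod_def reindex)
    finally show ?case .
  qed
  have "(\<Sum>x\<in>D. kernel_pow D F j x x) = (\<Sum>l\<leftarrow>ls. l ^ Suc j)" for j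
    unfolding ls(1)[symmetric] pow by (simp add: mat_trace_def reindex atLeast0LessThan)
  moreover have "kernel_eigenvalue D F l" if "l \<in> set ls" for l
    using ls(2)[OF that] kernel_eigenvalue_iff[OF e A_def] by simp
  ultimately show ?thesis using that by blast
qed

text \<open>An eigenvalue is a root of the characteristic polynomial, which is monic and, for an
  integral kernel, has integer coefficients.\<close>

lemma integral_kernel_eigenvalue_algebraic_int:
  assumes D: "finite D" and F: "\<And>x y. F x y \<in> \<int>" and l: "kernel_eigenvalue D F l"
  shows "algebraic_int l"
proof -
  define n where "n = card D"
  obtain e where e: "bij_betw e {0..<n} D"
    using ex_bij_betw_nat_finite[OF D] unfolding n_def by blast
  define A where "A = mat n n (\<lambda>(i, j). F (e i) (e j))"
  obtain f where f: "\<And>x y. F x y = of_int (f x y)"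
    using F unfolding Ints_def by (simp add: image_iff) metis
  define B where "B = mat n n (\<lambda>(i, j). f (e i) (e j))"
  have AB: "A = map_mat of_int B" by (rule eq_matI) (auto simp: A_def B_def f)
  have B: "B \<in> carrier_mat n n" by (simp add: B_def)
  have A: "A \<in> carrier_mat n n" by (simp add: A_def)
  have "poly (char_poly A) l = 0"
    using l kernel_eigenvalue_iff[OF e A_def] eigenvalue_root_char_poly[OF A] by simp
  moreover have "char_poly A = map_poly of_int (char_poly B)"
    unfolding AB by (rule of_int_hom.char_poly_hom[OF B])
  ultimately show ?thesis
    using degree_monic_char_poly[OF B] by (auto simp: algebraic_int_altdef_ipoly)
qed

section \<open>Recovering multiplicities from power sums\<close>

text \<open>Members of \<open>S\<close> outside the list have count 0; two spectra can therefore be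
  compared over one common index set.\<close>

lemma sum_list_map_eq_sum_count_subset:
  fixes f :: "'b \<Rightarrow> complex"
  assumes "set ls \<subseteq> S" "finite S"
  shows "(\<Sum>l\<leftarrow>ls. f l) = (\<Sum>l\<in>S. of_nat (count_list ls l) * f l)"
  using assms
proof (induction ls)
  case (Cons a ls)
  have "(\<Sum>l\<in>S. of_nat (count_list (a # ls) l) * f l) =
      (\<Sum>l\<in>S. (if l = a then f l else 0) + of_nat (count_list ls l) * f l)"
    by (intro sum.cong) (auto simp: algebra_simps)
  also have "\<dots> = f a + (\<Sum>l\<in>S. of_nat (count_list ls l) * f l)"
    using Cons.prems by (simp add: sum.distrib)
  finally show ?case using Cons by simp
qed simp

text \<open>Linearity passes from powers to \<open>l * poly p l\<close> for every polynomial
  \<open>p\<close>, and the polynomial with root set \<open>S - {m}\<close> isolates the term of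
  \<open>m\<close>. The surviving factor \<open>m\<close> is why 0 is excluded.\<close>

lemma power_sums_zero_imp_coeff_zero:
  fixes f :: "complex \<Rightarrow> complex"
  assumes S: "finite S" and zero: "\<And>j. (\<Sum>l\<in>S. f l * l ^ Suc j) = 0"
    and m: "m \<in> S" "m \<noteq> 0"
  shows "f m = 0"
proof -
  have poly: "(\<Sum>l\<in>S. f l * l * poly p l) = 0" for p
  proof -
    have "(\<Sum>l\<in>S. f l * l * poly p l) = (\<Sum>l\<in>S. \<Sum>i\<le>degree p. coeff p i * (f l * l ^ Suc i))"
      by (simp add: poly_altdef sum_distrib_left mult_ac)
    also have "\<dots> = (\<Sum>i\<le>degree p. coeff p i * (\<Sum>l\<in>S. f l * l ^ Suc i))"
      by (subst sum.swap) (simp only: sum_distrib_left)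
    finally show ?thesis using zero by simp
  qed
  define p where "p = (\<Prod>a\<in>S - {m}. [:- a, 1:])"
  have "poly p l = 0" if "l \<in> S" "l \<noteq> m" for l
    using that S by (auto simp: p_def poly_prod)
  then have "(\<Sum>l\<in>S. f l * l * poly p l) = (\<Sum>l\<in>{m}. f l * l * poly p l)"
    using S m by (intro sum.mono_neutral_right) auto
  then have "f m * m * poly p m = 0" using poly by simp
  moreover have "poly p m \<noteq> 0" using S by (auto simp: p_def poly_prod)
  ultimately show ?thesis using m by simp
qed

lemma kernel_pow_invariant:
  assumes s: "bij_betw s D D" and F: "\<And>x y. x \<in> D \<Longrightarrow> y \<in> D \<Longrightarrow> F (s x) (s y) = F x y"
  shows "x \<in> D \<Longrightarrow> y \<in> D \<Longrightarrow> kernel_pow D F j (s x) (s y) = kernel_pow D F j x y"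
proof (induction j arbitrary: y)
  case (Suc j)
  have "kernel_pow D F (Suc j) (s x) (s y) = (\<Sum>z\<in>D. kernel_pow D F j (s x) (s z) * F (s z) (s y))"
    unfolding kernel_pow.simps by (rule sum.reindex_bij_betw[OF s, symmetric])
  also have "\<dots> = kernel_pow D F (Suc j) x y"
    using Suc F by (auto intro!: sum.cong)
  finally show ?case .
qed (use F in auto)

text \<open>The averaged kernel is \<open>F\<close> followed by the operator
  \<open>(1 + s) / 2\<close>. This operator is idempotent, because \<open>s\<close> is an
  involution, and commutes with \<open>F\<close>, so a power contains it only once.\<close>

lemma kernel_pow_symmetrization:
  assumes s: "\<And>x. x \<in> D \<Longrightarrow> s x \<in> D" "\<And>x. x \<in> D \<Longrightarrow> s (s x) = x"
    and F: "\<And>x y. x \<in> D \<Longrightarrow> y \<in> D \<Longrightarrow> F (s x) (s y) = F x y"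
    and "x \<in> D" "y \<in> D"
  shows "kernel_pow D (\<lambda>x y. (F x y + F (s x) y) / 2) j x y =
    (kernel_pow D F j x y + kernel_pow D F j (s x) y) / 2"
  using \<open>y \<in> D\<close>
proof (induction j arbitrary: y)
  case (Suc j)
  have bij: "bij_betw s D D"
    by (rule bij_betwI[where g = s]) (use s in auto)
  let ?P = "kernel_pow D F j"
  \<comment> \<open>An inner \<open>s\<close> moves to the outer variable: substitute
    \<open>s z\<close> for \<open>z\<close> and use the invariance of \<open>?P\<close> under
    \<open>s\<close>.\<close>
  have swap: "(\<Sum>z\<in>D. ?P x' z * F (s z) y) = (\<Sum>z\<in>D. ?P (s x') z * F z y)" if x': "x' \<in> D" for x'
  proof -
    have "(\<Sum>z\<in>D. ?P x' z * F (s z) y) = (\<Sum>z\<in>D. ?P x' (s z) * F (s (s z)) y)"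
      by (rule sum.reindex_bij_betw[OF bij, symmetric])
    also have "\<dots> = (\<Sum>z\<in>D. ?P (s x') z * F z y)"
      using kernel_pow_invariant[where s = s and F = F and D = D and x = "s x'", OF bij F] x' s
      by (intro sum.cong) auto
    finally show ?thesis .
  qed
  have "kernel_pow D (\<lambda>x y. (F x y + F (s x) y) / 2) (Suc j) x y =
      (\<Sum>z\<in>D. (?P x z + ?P (s x) z) / 2 * ((F z y + F (s z) y) / 2))"
    unfolding kernel_pow.simps by (intro sum.cong refl) (simp only: Suc.IH)
  also have "\<dots> = ((\<Sum>z\<in>D. ?P x z * F z y) + (\<Sum>z\<in>D. ?P (s x) z * F z y)
      + ((\<Sum>z\<in>D. ?P x z * F (s z) y) + (\<Sum>z\<in>D. ?P (s x) z * F (s z) y))) / 4"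
    unfolding sum.distrib[symmetric] sum_divide_distrib by (intro sum.cong) (auto simp: field_simps)
  also have "\<dots> = (kernel_pow D F (Suc j) x y + kernel_pow D F (Suc j) (s x) y) / 2"
    using swap[OF \<open>x \<in> D\<close>] swap[OF s(1)[OF \<open>x \<in> D\<close>]] s(2)[OF \<open>x \<in> D\<close>] by simp
  finally show ?case .
qed simp

text \<open>The symmetrized kernel has the eigenvalue \<open>l\<close> with an integral multiplicity, which is half of
  the sum of the multiplicity for \<open>F\<close> and of the trace of \<open>s\<close> on the \<open>l\<close>-eigenspace of \<open>F\<close>.\<close>

lemma twisted_multiplicity_integral:
  assumes D: "finite D"
    and s: "\<And>x. x \<in> D \<Longrightarrow> s x \<in> D" "\<And>x. x \<in> D \<Longrightarrow> s (s x) = x"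
    and F: "\<And>x y. x \<in> D \<Longrightarrow> y \<in> D \<Longrightarrow> F (s x) (s y) = F x y"
    and tr: "\<And>j. (\<Sum>x\<in>D. kernel_pow D F j x x) = (\<Sum>l\<leftarrow>ls. l ^ Suc j)"
    and twisted: "\<And>j. (\<Sum>x\<in>D. kernel_pow D F j (s x) x) = (\<Sum>l\<leftarrow>ls. l ^ (Suc j + k)) / r"
    and l: "l \<in> set ls" "l \<noteq> 0"
  shows "of_nat (count_list ls l) * l ^ k / r \<in> \<int>"
proof -
  let ?A = "\<lambda>x y. (F x y + F (s x) y) / 2"
  obtain ms where ms: "\<And>j. (\<Sum>x\<in>D. kernel_pow D ?A j x x) = (\<Sum>m\<leftarrow>ms. m ^ Suc j)"
      "\<And>m. m \<in> set ms \<Longrightarrow> kernel_eigenvalue D ?A m"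
    by (rule kernel_spectrum[OF D, of ?A]) blast
  define S where "S = set ls \<union> set ms"
  have S: "finite S" "set ls \<subseteq> S" "set ms \<subseteq> S" by (auto simp: S_def)
  have eq: "2 * (\<Sum>m\<leftarrow>ms. m ^ Suc j) = (\<Sum>l\<leftarrow>ls. l ^ Suc j) + (\<Sum>l\<leftarrow>ls. l ^ (Suc j + k)) / r" for j
  proof -
    have "2 * (\<Sum>x\<in>D. kernel_pow D ?A j x x) =
        2 * (\<Sum>x\<in>D. (kernel_pow D F j x x + kernel_pow D F j (s x) x) / 2)"
      using kernel_pow_symmetrization[where s = s and F = F and D = D, OF s F]
      by (intro arg_cong[of _ _ "(*) 2"] sum.cong) auto
    also have "\<dots> = (\<Sum>x\<in>D. kernel_pow D F j x x) + (\<Sum>x\<in>D. kernel_pow D F j (s x) x)"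
      by (simp add: sum.distrib flip: sum_divide_distrib)
    finally show ?thesis using ms(1) tr twisted by simp
  qed
  \<comment> \<open>By \<open>twisted\<close>, the third term is the trace of \<open>s\<close> on
    the \<open>m\<close>-eigenspace. Thus \<open>f m\<close> is the defect in "twice the
    multiplicity for the average equals multiplicity plus trace"; \<open>eq\<close> makes all its
    power sums vanish.\<close>
  define f where "f m = 2 * of_nat (count_list ms m) - of_nat (count_list ls m)
      - of_nat (count_list ls m) * m ^ k / r" for m
  have "(\<Sum>m\<in>S. f m * m ^ Suc j) = 0" for j
  proof -
    have "(\<Sum>m\<in>S. f m * m ^ Suc j) = 2 * (\<Sum>m\<in>S. of_nat (count_list ms m) * m ^ Suc j)
        - (\<Sum>m\<in>S. of_nat (count_list ls m) * m ^ Suc j)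
        - (\<Sum>m\<in>S. of_nat (count_list ls m) * m ^ (Suc j + k)) / r"
      unfolding sum_distrib_left sum_divide_distrib sum_subtractf[symmetric]
      by (intro sum.cong) (auto simp: f_def algebra_simps power_add)
    then show ?thesis
      using eq[of j] S by (simp only: sum_list_map_eq_sum_count_subset) simp
  qed
  then have "f l = 0"
    using power_sums_zero_imp_coeff_zero[OF S(1)] l S(2) by blast
  then have "of_nat (count_list ls l) * l ^ k / r = 2 * of_nat (count_list ms l) - of_nat (count_list ls l)"
    by (simp add: f_def algebra_simps)
  also have "\<dots> \<in> \<int>" by (intro Ints_diff Ints_mult) auto
  finally show ?thesis .
qed

text \<open>Squaring the first equation and dividing by the second yields
  \<open>a\<^sup>2 = int n * b\<close>. If 3 did not divide \<open>a\<close>, it would not divide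
  \<open>n\<close> either, and the first equation would make \<open>3 ^ c\<close> a divisor of
  \<open>l\<close>, which is nonzero and too small.\<close>

lemma three_dvd_of_norm_less:
  fixes a b l :: int and n :: nat
  assumes "int n * l = 3 ^ c * a" "int n * l\<^sup>2 = (3 ^ c)\<^sup>2 * b" "l \<noteq> 0" "\<bar>l\<bar> < 3 ^ c"
  shows "3 dvd a"
proof (rule ccontr)
  assume a: "\<not> 3 dvd a"
  have "(3 ^ c)\<^sup>2 * a\<^sup>2 = (int n * l) * (int n * l)"
    unfolding assms(1) by (simp add: power2_eq_square)
  also have "\<dots> = int n * (int n * l\<^sup>2)" by (simp add: power2_eq_square)
  also have "\<dots> = (3 ^ c)\<^sup>2 * (int n * b)" unfolding assms(2) by simp
  finally have "a\<^sup>2 = int n * b" by simp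
  then have "\<not> 3 dvd int n"
    using a prime_dvd_power[of "3::int" a 2] by (auto dest: dvd_mult2)
  then have "coprime (3 ^ c) (int n)"
    by (intro coprime_power_left_iff[THEN iffD2] disjI1 prime_imp_coprime) auto
  then have "3 ^ c dvd l"
    using assms(1) by (metis coprime_dvd_mult_right_iff dvd_triv_left)
  then show False
    using assms(3,4) zdvd_imp_le[of "3 ^ c" "\<bar>l\<bar>"] by auto
qed

section \<open>Conjugacy classes of involutions\<close>

context group
begin

lemma inv_mult_cancel [simp]:
  assumes "x \<in> carrier G" "y \<in> carrier G"
  shows "inv x \<otimes> (x \<otimes> y) = y" "x \<otimes> (inv x \<otimes> y) = y"
  using assms by (simp_all flip: m_assoc)

definition conj_class :: "'a \<Rightarrow> 'a set" where
  "conj_class t = (\<lambda>g. g \<otimes> t \<otimes> inv g) ` carrier G"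

lemma conj_class_subset: "t \<in> carrier G \<Longrightarrow> conj_class t \<subseteq> carrier G"
  by (auto simp: conj_class_def)

lemma self_in_conj_class: "t \<in> carrier G \<Longrightarrow> t \<in> conj_class t"
  by (auto simp: conj_class_def image_iff intro!: bexI[of _ \<one>])

lemma conj_class_conj:
  assumes "t \<in> carrier G" "c \<in> conj_class t" "g \<in> carrier G"
  shows "g \<otimes> c \<otimes> inv g \<in> conj_class t"
proof -
  obtain h where h: "h \<in> carrier G" "c = h \<otimes> t \<otimes> inv h"
    using assms by (auto simp: conj_class_def)
  then have "g \<otimes> c \<otimes> inv g = (g \<otimes> h) \<otimes> t \<otimes> inv (g \<otimes> h)"
    using assms by (simp add: m_assoc inv_mult_group)
  then show ?thesis using assms h unfolding conj_class_def by blast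
qed

lemma conj_class_involution:
  assumes "t \<in> carrier G" "t \<otimes> t = \<one>" "c \<in> conj_class t"
  shows "c \<otimes> c = \<one>" "inv c = c"
proof -
  obtain h where h: "h \<in> carrier G" "c = h \<otimes> t \<otimes> inv h"
    using assms by (auto simp: conj_class_def)
  have "h \<otimes> t \<otimes> inv h \<otimes> (h \<otimes> t \<otimes> inv h) = h \<otimes> (t \<otimes> t) \<otimes> inv h"
    using h(1) assms(1) by (simp add: m_assoc)
  then show "c \<otimes> c = \<one>"
    using h assms by simp
  then show "inv c = c"
    using h assms by (simp add: inv_equality)
qed

lemma conj_in_conj_class_iff:
  assumes "t \<in> carrier G" "g \<in> carrier G" "x \<in> carrier G"
  shows "g \<otimes> x \<otimes> inv g \<in> conj_class t \<longleftrightarrow> x \<in> conj_class t"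
proof
  assume "g \<otimes> x \<otimes> inv g \<in> conj_class t"
  from conj_class_conj[OF assms(1) this, of "inv g"] show "x \<in> conj_class t"
    using assms by (simp add: m_assoc)
qed (use assms conj_class_conj in auto)

section \<open>Sums over a group and over a class\<close>

lemma sum_left_mult:
  assumes "g \<in> carrier G"
  shows "(\<Sum>x\<in>carrier G. f (g \<otimes> x)) = (\<Sum>x\<in>carrier G. f x)"
  by (rule sum.reindex_bij_witness[of _ "\<lambda>x. inv g \<otimes> x" "\<lambda>x. g \<otimes> x"])
    (use assms in \<open>auto simp: m_assoc[symmetric]\<close>)

lemma sum_right_mult:
  assumes "g \<in> carrier G"
  shows "(\<Sum>x\<in>carrier G. f (x \<otimes> g)) = (\<Sum>x\<in>carrier G. f x)"
  by (rule sum.reindex_bij_witness[of _ "\<lambda>x. x \<otimes> inv g" "\<lambda>x. x \<otimes> g"])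
    (use assms in \<open>auto simp: m_assoc\<close>)

lemma sum_inv:
  shows "(\<Sum>x\<in>carrier G. f (inv x)) = (\<Sum>x\<in>carrier G. f x)"
  by (rule sum.reindex_bij_witness[of _ "\<lambda>x. inv x" "\<lambda>x. inv x"]) auto

text \<open>The double sum of \<open>h (x \<otimes> c \<otimes> inv x)\<close> over group elements
  \<open>x\<close> and class members \<open>c\<close> is evaluated in both orders: the sum over
  \<open>x\<close> is the same for every \<open>c\<close>, and the sum over \<open>c\<close> is the
  same for every \<open>x\<close>.\<close>

lemma sum_conjugates:
  fixes h :: "'a \<Rightarrow> complex"
  assumes fin: "finite (carrier G)" and t: "t \<in> carrier G"
  shows "of_nat (card (conj_class t)) * (\<Sum>x\<in>carrier G. h (x \<otimes> t \<otimes> inv x)) =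
    of_nat (card (carrier G)) * (\<Sum>c\<in>conj_class t. h c)"
proof -
  have same: "(\<Sum>x\<in>carrier G. h (x \<otimes> c \<otimes> inv x)) = (\<Sum>x\<in>carrier G. h (x \<otimes> t \<otimes> inv x))"
    if c: "c \<in> conj_class t" for c
  proof -
    obtain g where g: "g \<in> carrier G" "c = g \<otimes> t \<otimes> inv g"
      using c by (auto simp: conj_class_def)
    have "(\<Sum>x\<in>carrier G. h (x \<otimes> c \<otimes> inv x)) =
        (\<Sum>x\<in>carrier G. h ((x \<otimes> g) \<otimes> t \<otimes> inv (x \<otimes> g)))"
      using g t by (intro sum.cong) (auto simp: m_assoc inv_mult_group)
    also have "\<dots> = (\<Sum>x\<in>carrier G. h (x \<otimes> t \<otimes> inv x))"
      by (rule sum_right_mult[OF g(1), of "\<lambda>x. h (x \<otimes> t \<otimes> inv x)"])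
    finally show ?thesis .
  qed
  have perm: "(\<Sum>c\<in>conj_class t. h (x \<otimes> c \<otimes> inv x)) = (\<Sum>c\<in>conj_class t. h c)"
    if x: "x \<in> carrier G" for x
  proof (rule sum.reindex_bij_witness[of _ "\<lambda>c. inv x \<otimes> c \<otimes> x" "\<lambda>c. x \<otimes> c \<otimes> inv x"])
    fix c assume c: "c \<in> conj_class t"
    then have "c \<in> carrier G" using conj_class_subset[OF t] by auto
    then show "inv x \<otimes> (x \<otimes> c \<otimes> inv x) \<otimes> x = c" "x \<otimes> (inv x \<otimes> c \<otimes> x) \<otimes> inv x = c"
      using x by (auto simp: m_assoc)
    show "x \<otimes> c \<otimes> inv x \<in> conj_class t" using conj_class_conj[OF t c x] .
    show "inv x \<otimes> c \<otimes> x \<in> conj_class t" using conj_class_conj[OF t c, of "inv x"] x by simp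
  qed simp
  have "of_nat (card (conj_class t)) * (\<Sum>x\<in>carrier G. h (x \<otimes> t \<otimes> inv x)) =
      (\<Sum>c\<in>conj_class t. \<Sum>x\<in>carrier G. h (x \<otimes> c \<otimes> inv x))"
    using same by simp
  also have "\<dots> = (\<Sum>x\<in>carrier G. \<Sum>c\<in>conj_class t. h (x \<otimes> c \<otimes> inv x))"
    by (rule sum.swap)
  also have "\<dots> = of_nat (card (carrier G)) * (\<Sum>c\<in>conj_class t. h c)"
    using perm by simp
  finally show ?thesis .
qed

section \<open>A maximum principle for class sums\<close>

text \<open>If \<open>l\<close> were as large as the class, then at a point where the absolute value
  of \<open>w\<close> is maximal every class member would multiply \<open>w\<close> by exactly
  \<open>sgn l\<close>. Products of two class members then preserve \<open>w\<close>; they generate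
  a nontrivial normal subgroup, hence all of \<open>G\<close>, and \<open>w\<close> is constant with
  sum 0.\<close>

lemma class_average_strict_contraction:
  fixes w :: "'a \<Rightarrow> real"
  assumes fin: "finite (carrier G)"
    and simple: "\<And>N. N \<lhd> G \<Longrightarrow> N = {\<one>} \<or> N = carrier G"
    and t: "t \<in> carrier G" "t \<otimes> t = \<one>" and card: "card (conj_class t) > 1"
    and w: "\<And>x. x \<in> carrier G \<Longrightarrow> (\<Sum>c\<in>conj_class t. w (c \<otimes> x)) = l * w x"
    and sum0: "(\<Sum>x\<in>carrier G. w x) = 0" and nz: "x \<in> carrier G" "w x \<noteq> 0"
  shows "\<bar>l\<bar> < real (card (conj_class t))"
proof (rule ccontr)
  let ?C = "conj_class t"
  assume "\<not> ?thesis"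
  then have l: "real (card ?C) \<le> \<bar>l\<bar>" by simp
  have C: "c \<in> carrier G" if "c \<in> ?C" for c using conj_class_subset[OF t(1)] that by auto
  have finC: "finite ?C" using fin C by (meson finite_subset subsetI)
  define M where "M = Max ((\<lambda>x. \<bar>w x\<bar>) ` carrier G)"
  have le: "\<bar>w x\<bar> \<le> M" if "x \<in> carrier G" for x
    unfolding M_def using fin that by (intro Max_ge) auto
  have "M > 0" using le[OF nz(1)] nz(2) by simp
  have "M \<in> (\<lambda>x. \<bar>w x\<bar>) ` carrier G"
    unfolding M_def using fin nz by (intro Max_in) auto
  then obtain x0 where x0: "x0 \<in> carrier G" "\<bar>w x0\<bar> = M" by auto
  have step: "w (c \<otimes> x) = sgn l * w x" if x: "x \<in> carrier G" "\<bar>w x\<bar> = M" and c: "c \<in> ?C" for x c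
  proof -
    \<comment> \<open>With this sign the terms \<open>M - e * w (d \<otimes> x)\<close> have sum at
      most 0. Each is nonnegative by maximality of \<open>M\<close>, so each is 0.\<close>
    define e where "e = sgn l * sgn (w x)"
    have "w x \<noteq> 0" using x \<open>M > 0\<close> by auto
    have "l \<noteq> 0" using l card by auto
    have e: "\<bar>e\<bar> = 1" using \<open>w x \<noteq> 0\<close> \<open>l \<noteq> 0\<close> by (simp add: e_def abs_mult abs_sgn_eq)
    have nonneg: "0 \<le> M - e * w (d \<otimes> x)" if "d \<in> ?C" for d
    proof -
      have "e * w (d \<otimes> x) \<le> \<bar>e * w (d \<otimes> x)\<bar>" by simp
      also have "\<dots> = \<bar>w (d \<otimes> x)\<bar>" using e by (simp add: abs_mult)
      finally show ?thesis using le[of "d \<otimes> x"] C[OF that] x by simp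
    qed
    have "(\<Sum>d\<in>?C. M - e * w (d \<otimes> x)) = real (card ?C) * M - e * (l * w x)"
      using w[OF x(1)] by (simp add: sum_subtractf flip: sum_distrib_left)
    also have "e * (l * w x) = \<bar>l\<bar> * M"
      unfolding x(2)[symmetric] by (simp add: e_def abs_sgn mult_ac)
    also have "real (card ?C) * M - \<bar>l\<bar> * M \<le> 0"
      using l \<open>M > 0\<close> by simp
    finally have "(\<Sum>d\<in>?C. M - e * w (d \<otimes> x)) \<le> 0" .
    then have "(\<Sum>d\<in>?C. M - e * w (d \<otimes> x)) = 0"
      using sum_nonneg[of ?C "\<lambda>d. M - e * w (d \<otimes> x)"] nonneg by simp
    then have "M = e * w (c \<otimes> x)"
      using sum_nonneg_eq_0_iff[OF finC nonneg] c by auto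
    moreover have "e = 1 \<or> e = - 1" using e by linarith
    ultimately have "e * M = w (c \<otimes> x)" by auto
    moreover have "e * M = sgn l * w x"
      unfolding x(2)[symmetric] e_def by (simp add: sgn_mult_abs mult.assoc)
    ultimately show ?thesis by simp
  qed
  \<comment> \<open>Products of two class members are used because the two factors
    \<open>sgn l\<close> cancel, also when \<open>l\<close> is negative.\<close>
  define H where "H = generate G {c \<otimes> d | c d. c \<in> ?C \<and> d \<in> ?C}"
  have "H \<lhd> G" unfolding H_def
  proof (rule normal_generateI)
    show "{c \<otimes> d | c d. c \<in> ?C \<and> d \<in> ?C} \<subseteq> carrier G" using C by auto
    fix h g assume "h \<in> {c \<otimes> d | c d. c \<in> ?C \<and> d \<in> ?C}" and g: "g \<in> carrier G"
    then obtain c d where cd: "c \<in> ?C" "d \<in> ?C" "h = c \<otimes> d" by auto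
    have "g \<otimes> h \<otimes> inv g = (g \<otimes> c \<otimes> inv g) \<otimes> (g \<otimes> d \<otimes> inv g)"
      using cd C g by (simp add: m_assoc)
    then show "g \<otimes> h \<otimes> inv g \<in> {c \<otimes> d | c d. c \<in> ?C \<and> d \<in> ?C}"
      using conj_class_conj[OF t(1)] cd g by blast
  qed
  moreover have "H \<noteq> {\<one>}"
  proof
    assume H: "H = {\<one>}"
    obtain d where d: "d \<in> ?C" "d \<noteq> t"
      using card finC by (metis card_1_singleton_iff card.empty is_singletonI' is_singleton_altdef
          less_irrefl not_one_less_zero self_in_conj_class t(1) empty_iff)
    have "d \<otimes> t \<in> H"
      unfolding H_def using d self_in_conj_class[OF t(1)] by (intro generate.incl) auto
    then have "d \<otimes> t = \<one>" using H by simp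
    then have "inv t = d" using inv_equality C[OF d(1)] t(1) by auto
    then show False using d(2) t inv_equality by auto
  qed
  ultimately have H: "H = carrier G" using simple by blast
  have H_inv: "w (h \<otimes> x) = w x" if "h \<in> H" "x \<in> carrier G" "\<bar>w x\<bar> = M" for h x
    using that unfolding H_def
  proof (induction h arbitrary: x)
    case (incl h)
    then obtain c d where cd: "c \<in> ?C" "d \<in> ?C" "h = c \<otimes> d" by auto
    have "\<bar>sgn l\<bar> = 1" using l card by (auto simp: abs_sgn_eq)
    have "w (c \<otimes> (d \<otimes> x)) = sgn l * (sgn l * w x)"
      using step[OF incl(2,3) cd(2)] step[of "d \<otimes> x" c] cd C incl \<open>\<bar>sgn l\<bar> = 1\<close>
      by (simp add: abs_mult)
    also have "\<dots> = w x" using \<open>\<bar>sgn l\<bar> = 1\<close> by (cases "sgn l = 1") auto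
    finally show ?case using cd C incl by (simp add: m_assoc)
  next
    case (inv h)
    then obtain c d where cd: "c \<in> ?C" "d \<in> ?C" "h = c \<otimes> d" by auto
    then have ih: "inv h = d \<otimes> c" using conj_class_involution[OF t] C by (simp add: inv_mult_group)
    have "\<bar>sgn l\<bar> = 1" using l card by (auto simp: abs_sgn_eq)
    have "w (d \<otimes> (c \<otimes> x)) = sgn l * (sgn l * w x)"
      using step[OF inv(2,3) cd(1)] step[of "c \<otimes> x" d] cd C inv \<open>\<bar>sgn l\<bar> = 1\<close>
      by (simp add: abs_mult)
    also have "\<dots> = w x" using \<open>\<bar>sgn l\<bar> = 1\<close> by (cases "sgn l = 1") auto
    finally show ?case using cd C inv ih by (simp add: m_assoc)
  next
    case (eng h1 h2)
    have h: "h1 \<in> carrier G" "h2 \<in> carrier G" using eng(1,2) H unfolding H_def by auto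
    then have "w (h1 \<otimes> (h2 \<otimes> x)) = w x" using eng by simp
    then show ?case using h eng by (simp add: m_assoc)
  qed simp
  have "w x = w x0" if "x \<in> carrier G" for x
    using H_inv[of "x \<otimes> inv x0" x0] that x0 H by (simp add: m_assoc)
  then have "(\<Sum>x\<in>carrier G. w x) = real (card (carrier G)) * w x0" by simp
  then show False using sum0 x0 \<open>M > 0\<close> fin by auto
qed

section \<open>The eigenvalue argument for an involution class of size a power of 3\<close>

lemma simple_involution_class_not_three_power:
  assumes fin: "finite (carrier G)"
    and simple: "\<And>N. N \<lhd> G \<Longrightarrow> N = {\<one>} \<or> N = carrier G"
    and t: "t \<in> carrier G" "t \<noteq> \<one>" "t \<otimes> t = \<one>"
    and card: "card (conj_class t) = 3 ^ c" "c > 0"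
  shows False
proof -
  let ?C = "conj_class t" and ?D = "carrier G"
  define n where "n = card ?D"
  define q where "q = card ?C"
  have "?D \<noteq> {}" by auto
  then have n: "n > 0" using fin by (simp add: n_def card_gt_0_iff)
  have q: "q = 3 ^ c" "q > 1" using card one_less_power[of "3::nat" c] by (auto simp: q_def)
  have C: "d \<in> carrier G" if "d \<in> ?C" for d using conj_class_subset[OF t(1)] that by auto
  have finC: "finite ?C" using fin C by (meson finite_subset subsetI)
  have one: "\<one> \<notin> ?C"
  proof
    assume "\<one> \<in> ?C"
    then obtain g where g: "g \<in> ?D" "\<one> = g \<otimes> t \<otimes> inv g" by (auto simp: conj_class_def)
    have "t = inv g \<otimes> (g \<otimes> t \<otimes> inv g) \<otimes> g" using g(1) t(1) by (simp add: m_assoc)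
    also have "\<dots> = \<one>" unfolding g(2)[symmetric] using g(1) by simp
    finally show False using t(2) by simp
  qed
  \<comment> \<open>Subtracting the mean \<open>q / n\<close> of the class indicator kills the
    constants and leaves the class sum unchanged on functions with sum 0.\<close>
  define f :: "'a \<Rightarrow> complex" where "f g = of_bool (g \<in> ?C) - of_nat q / of_nat n" for g
  define F where "F x y = f (x \<otimes> inv y)" for x y
  define P where "P = kernel_pow ?D F"
  have F_right: "F (x \<otimes> h) (y \<otimes> h) = F x y" if "x \<in> ?D" "y \<in> ?D" "h \<in> ?D" for x y h
    using that by (simp add: F_def m_assoc inv_mult_group)
  have F_left: "F (h \<otimes> x) (h \<otimes> y) = F x y" if "x \<in> ?D" "y \<in> ?D" "h \<in> ?D" for x y h
  proof -
    have "(h \<otimes> x) \<otimes> inv (h \<otimes> y) = h \<otimes> (x \<otimes> inv y) \<otimes> inv h"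
      using that by (simp add: m_assoc inv_mult_group)
    then show ?thesis using conj_in_conj_class_iff[OF t(1), of h "x \<otimes> inv y"] that by (simp add: F_def f_def)
  qed
  have P_right: "P j (x \<otimes> h) (y \<otimes> h) = P j x y" if "x \<in> ?D" "y \<in> ?D" "h \<in> ?D" for j x y h
    unfolding P_def
  proof (rule kernel_pow_invariant[where s = "\<lambda>x. x \<otimes> h"])
    show "bij_betw (\<lambda>x. x \<otimes> h) ?D ?D"
      by (rule bij_betwI[where g = "\<lambda>x. x \<otimes> inv h"]) (use that in \<open>auto simp: m_assoc\<close>)
  qed (use that F_right in auto)
  have P_left: "P j (h \<otimes> x) (h \<otimes> y) = P j x y" if "x \<in> ?D" "y \<in> ?D" "h \<in> ?D" for j x y h
    unfolding P_def
  proof (rule kernel_pow_invariant[where s = "\<lambda>x. h \<otimes> x"])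
    show "bij_betw (\<lambda>x. h \<otimes> x) ?D ?D"
      by (rule bij_betwI[where g = "\<lambda>x. inv h \<otimes> x"]) (use that in auto)
  qed (use that F_left in auto)
  have sum_f: "(\<Sum>x\<in>?D. f x) = 0"
  proof -
    have "?D \<inter> ?C = ?C" using C by auto
    then have "(\<Sum>x\<in>?D. of_bool (x \<in> ?C) :: complex) = of_nat q"
      using fin by (simp add: q_def)
    then show ?thesis using n by (simp add: f_def sum_subtractf n_def)
  qed
  have row: "(\<Sum>y\<in>?D. F x y) = 0" if "x \<in> ?D" for x
  proof -
    have "(\<Sum>y\<in>?D. F x y) = (\<Sum>y\<in>?D. f (x \<otimes> y))"
      unfolding F_def by (rule sum_inv[of "\<lambda>y. f (x \<otimes> y)"])
    then show ?thesis using sum_left_mult[OF that, of f] sum_f by simp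
  qed
  have col: "(\<Sum>x\<in>?D. F x y) = 0" if "y \<in> ?D" for y
    unfolding F_def using sum_right_mult[of "inv y" f] that sum_f by simp
  have P_row: "(\<Sum>y\<in>?D. P j x y) = 0" if "x \<in> ?D" for j x
  proof (cases j)
    case (Suc i)
    have "(\<Sum>y\<in>?D. P j x y) = (\<Sum>z\<in>?D. \<Sum>y\<in>?D. P i x z * F z y)"
      unfolding Suc P_def kernel_pow.simps by (rule sum.swap)
    then show ?thesis using row by (simp flip: sum_distrib_left)
  qed (use row that in \<open>simp add: P_def\<close>)
  \<comment> \<open>The subtracted constant contributes nothing, since every row of a power of
    \<open>F\<close> sums to 0.\<close>
  have P_Suc: "P (Suc j) x \<one> = (\<Sum>d\<in>?C. P j x d)" if "x \<in> ?D" for j x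
  proof -
    have "P (Suc j) x \<one> = (\<Sum>z\<in>?D. P j x z * of_bool (z \<in> ?C) - of_nat q / of_nat n * P j x z)"
      unfolding P_def kernel_pow.simps by (intro sum.cong) (auto simp: F_def f_def algebra_simps)
    also have "\<dots> = (\<Sum>z\<in>?D. P j x z * of_bool (z \<in> ?C))"
      using P_row[OF that, of j] by (simp only: sum_subtractf sum_distrib_left[symmetric]) simp
    also have "\<dots> = (\<Sum>z\<in>?C. P j x z)"
      using fin C by (intro sum.mono_neutral_cong_right) auto
    finally show ?thesis .
  qed
  \<comment> \<open>Left and right translations preserve the powers of \<open>F\<close>, so these
    are constant on the class. Consequently one further factor \<open>F\<close> in a trace amounts
    to a translation by \<open>t\<close> and a factor \<open>q\<close>.\<close>
  have P_t: "P (Suc j) \<one> \<one> = of_nat q * P j t \<one>" for j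
  proof -
    have "P j \<one> d = P j t \<one>" if "d \<in> ?C" for d
    proof -
      obtain g where g: "g \<in> ?D" "d = g \<otimes> t \<otimes> inv g" using \<open>d \<in> ?C\<close> by (auto simp: conj_class_def)
      have "P j \<one> d = P j (g \<otimes> \<one> \<otimes> inv g) (g \<otimes> t \<otimes> inv g)" using g by simp
      also have "\<dots> = P j \<one> t" using P_right[of "g \<otimes> \<one>" "g \<otimes> t" "inv g" j] P_left[of \<one> t g j] g t by simp
      also have "\<dots> = P j t \<one>" using P_left[of \<one> t t j] t by simp
      finally show ?thesis .
    qed
    then show ?thesis using P_Suc[of \<one> j] by (simp add: q_def)
  qed
  have P_diag: "P j x x = P j \<one> \<one>" if "x \<in> ?D" for j x
    using P_right[of \<one> \<one> x j] that by simp
  obtain ls where ls: "\<And>j. (\<Sum>x\<in>?D. kernel_pow ?D F j x x) = (\<Sum>l\<leftarrow>ls. l ^ Suc j)"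
      "\<And>l. l \<in> set ls \<Longrightarrow> kernel_eigenvalue ?D F l"
    by (rule kernel_spectrum[OF fin, of F]) blast
  have tr: "of_nat n * P j \<one> \<one> = (\<Sum>l\<leftarrow>ls. l ^ Suc j)" for j
  proof -
    have "(\<Sum>x\<in>?D. P j x x) = (\<Sum>x\<in>?D. P j \<one> \<one>)" by (intro sum.cong refl P_diag)
    then show ?thesis using ls(1)[of j] by (simp add: n_def P_def)
  qed
  \<comment> \<open>The involution \<open>x \<mapsto> t \<otimes> x\<close>: its twisted traces are
    those of the next power of \<open>F\<close> divided by \<open>q\<close>.\<close>
  have int1: "of_nat (count_list ls l) * l ^ 1 / of_nat q \<in> \<int>" if "l \<in> set ls" "l \<noteq> 0" for l
  proof (rule twisted_multiplicity_integral[where s = "\<lambda>x. t \<otimes> x" and D = ?D and F = F])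
    fix j
    have "(\<Sum>x\<in>?D. P j (t \<otimes> x) x) = of_nat n * P j t \<one>"
      using P_right[of t \<one> _ j] t by (simp add: n_def)
    also have "\<dots> = (\<Sum>l\<leftarrow>ls. l ^ (Suc j + 1)) / of_nat q"
      using tr[of "Suc j"] P_t[of j] q(2) by (simp add: field_simps)
    finally show "(\<Sum>x\<in>?D. kernel_pow ?D F j (t \<otimes> x) x) = (\<Sum>l\<leftarrow>ls. l ^ (Suc j + 1)) / of_nat q"
      by (simp add: P_def)
  qed (use that fin t F_left ls in \<open>auto simp flip: m_assoc\<close>)
  have int2: "of_nat (count_list ls l) * l ^ 2 / (of_nat q)\<^sup>2 \<in> \<int>" if "l \<in> set ls" "l \<noteq> 0" for l
  proof (rule twisted_multiplicity_integral[where s = "\<lambda>x. t \<otimes> x \<otimes> t" and D = ?D and F = F])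
    fix j
    \<comment> \<open>Right translation by \<open>t \<otimes> inv x\<close> turns the twisted trace
      into a sum over the conjugates of \<open>t\<close>. \<open>sum_conjugates\<close> gives the
      first factor \<open>1 / q\<close>, and \<open>P_t\<close> the second.\<close>
    have "(\<Sum>x\<in>?D. P j (t \<otimes> x \<otimes> t) x) = (\<Sum>x\<in>?D. P j t (x \<otimes> t \<otimes> inv x))"
    proof (rule sum.cong)
      fix x assume x: "x \<in> ?D"
      have "t \<otimes> (t \<otimes> inv x) = inv x" using t x by (simp flip: m_assoc)
      then have "(t \<otimes> x \<otimes> t) \<otimes> (t \<otimes> inv x) = t" "x \<otimes> (t \<otimes> inv x) = x \<otimes> t \<otimes> inv x"
        using t x by (simp_all add: m_assoc)
      then show "P j (t \<otimes> x \<otimes> t) x = P j t (x \<otimes> t \<otimes> inv x)"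
        using P_right[of "t \<otimes> x \<otimes> t" x "t \<otimes> inv x" j] t x by simp
    qed simp
    then have "of_nat q * (\<Sum>x\<in>?D. P j (t \<otimes> x \<otimes> t) x) = of_nat n * P (Suc j) t \<one>"
      using sum_conjugates[OF fin t(1), of "P j t"] P_Suc[OF t(1), of j] by (simp add: n_def q_def)
    then have "(\<Sum>x\<in>?D. P j (t \<otimes> x \<otimes> t) x) = (\<Sum>l\<leftarrow>ls. l ^ (Suc j + 2)) / (of_nat q)\<^sup>2"
      using tr[of "Suc (Suc j)"] P_t[of "Suc j"] q(2) by (simp add: field_simps power2_eq_square)
    then show "(\<Sum>x\<in>?D. kernel_pow ?D F j (t \<otimes> x \<otimes> t) x) = (\<Sum>l\<leftarrow>ls. l ^ (Suc j + 2)) / (of_nat q)\<^sup>2"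
      by (simp add: P_def)
  next
    fix x assume "x \<in> ?D"
    then show "t \<otimes> (t \<otimes> x \<otimes> t) \<otimes> t = x"
      using t by (metis l_one m_assoc m_closed r_one)
  qed (use that fin t F_left F_right ls in auto)
  have key: "\<exists>a::int. of_nat (count_list ls l) * l = of_nat q * of_int (3 * a)" if l: "l \<in> set ls" for l
  proof (cases "l = 0")
    case False
    define m where "m = count_list ls l"
    have m: "m > 0" using l by (simp add: m_def count_list_0_iff flip: neq0_conv)
    obtain a where a: "of_nat m * l = of_nat q * of_int a"
      using int1[OF l False] q(2) by (auto elim!: Ints_cases simp: m_def field_simps)
    obtain b where b: "of_nat m * l\<^sup>2 = (of_nat q)\<^sup>2 * of_int b"
      using int2[OF l False] q(2) by (auto elim!: Ints_cases simp: m_def field_simps)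
    obtain v x where v: "x \<in> ?D" "v x \<noteq> 0" "\<And>x. x \<in> ?D \<Longrightarrow> (\<Sum>y\<in>?D. F x y * v y) = l * v x"
      using ls(2)[OF l] unfolding kernel_eigenvalue_def by blast
    \<comment> \<open>Columns of \<open>F\<close> sum to 0, so an eigenvector for
      \<open>l \<noteq> 0\<close> has sum 0. It is therefore also an eigenvector of the uncorrected
      class sum, whose kernel is integral.\<close>
    have "l * (\<Sum>x\<in>?D. v x) = (\<Sum>x\<in>?D. \<Sum>y\<in>?D. F x y * v y)"
      using v(3) by (simp add: sum_distrib_left)
    also have "\<dots> = (\<Sum>y\<in>?D. (\<Sum>x\<in>?D. F x y) * v y)"
      by (subst sum.swap) (simp add: sum_distrib_right)
    finally have v0: "(\<Sum>x\<in>?D. v x) = 0" using col False by simp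
    have eig: "(\<Sum>y\<in>?D. of_bool (x \<otimes> inv y \<in> ?C) * v y) = l * v x" if "x \<in> ?D" for x
    proof -
      have "(\<Sum>y\<in>?D. of_bool (x \<otimes> inv y \<in> ?C) * v y) =
          (\<Sum>y\<in>?D. F x y * v y + of_nat q / of_nat n * v y)"
        by (intro sum.cong) (auto simp: F_def f_def algebra_simps)
      also have "\<dots> = l * v x"
        using v(3)[OF that] v0 by (simp only: sum.distrib sum_distrib_left[symmetric]) simp
      finally show ?thesis .
    qed
    then have "kernel_eigenvalue ?D (\<lambda>x y. of_bool (x \<otimes> inv y \<in> ?C)) l"
      unfolding kernel_eigenvalue_def using v(1,2) by blast
    then have "algebraic_int l"
      by (rule integral_kernel_eigenvalue_algebraic_int[OF fin, rotated]) auto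
    moreover have "l \<in> \<rat>"
    proof -
      have "l = of_int (int q * a) / of_int (int m)" using a m by (simp add: field_simps)
      then show ?thesis by simp
    qed
    ultimately have "l \<in> \<int>" by (rule rational_algebraic_int_is_int)
    then obtain k where k: "l = of_int k" by (auto elim: Ints_cases)
    have avg: "(\<Sum>d\<in>?C. v (d \<otimes> x)) = l * v x" if x: "x \<in> ?D" for x
    proof -
      \<comment> \<open>The substitution \<open>y = d \<otimes> x\<close> works since class members
        are their own inverses: \<open>x \<otimes> inv y\<close> and
        \<open>y \<otimes> inv x\<close> agree when either lies in the class.\<close>
      have "(\<Sum>d\<in>?C. v (d \<otimes> x)) = (\<Sum>y\<in>{y \<in> ?D. x \<otimes> inv y \<in> ?C}. v y)"
      proof (rule sum.reindex_bij_witness[where i = "\<lambda>y. x \<otimes> inv y" and j = "\<lambda>d. d \<otimes> x"])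
        fix d assume "d \<in> ?C"
        then have d: "d \<in> ?C" "d \<in> ?D" "inv d = d" using C conj_class_involution[OF t(1,3)] by auto
        then show "x \<otimes> inv (d \<otimes> x) = d" using x by (simp add: inv_mult_group)
        then show "d \<otimes> x \<in> {y \<in> ?D. x \<otimes> inv y \<in> ?C}" using d x by auto
      next
        fix y assume "y \<in> {y \<in> ?D. x \<otimes> inv y \<in> ?C}"
        then have y: "y \<in> ?D" "x \<otimes> inv y \<in> ?C" by auto
        then have "x \<otimes> inv y = inv (x \<otimes> inv y)" using conj_class_involution[OF t(1,3)] by auto
        then have "x \<otimes> inv y = y \<otimes> inv x" using x y by (simp add: inv_mult_group)
        then show "x \<otimes> inv y \<otimes> x = y" using x y by (simp add: m_assoc)
        show "x \<otimes> inv y \<in> ?C" using y by simp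
      qed simp
      also have "\<dots> = (\<Sum>y\<in>?D. of_bool (x \<otimes> inv y \<in> ?C) * v y)"
        using fin by (intro sum.mono_neutral_cong_left) auto
      finally have "(\<Sum>d\<in>?C. v (d \<otimes> x)) = (\<Sum>y\<in>?D. of_bool (x \<otimes> inv y \<in> ?C) * v y)" .
      then show ?thesis using eig[OF x] by simp
    qed
    have "\<bar>real_of_int k\<bar> < real q"
    \<comment> \<open>The contraction bound concerns real functions. As \<open>l\<close> is an
      integer, the real and imaginary parts of \<open>v\<close> satisfy the same equation, and one
      of them is nonzero at \<open>x\<close>.\<close>
    proof (cases "Re (v x) = 0")
      case True
      then have "Im (v x) \<noteq> 0" using v(2) by (simp add: complex_eq_iff)
      moreover have "(\<Sum>d\<in>?C. Im (v (d \<otimes> x))) = real_of_int k * Im (v x)" if "x \<in> ?D" for x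
        using arg_cong[OF avg[OF that], of Im] k by simp
      moreover have "(\<Sum>x\<in>?D. Im (v x)) = 0" using arg_cong[OF v0, of Im] by simp
      ultimately show ?thesis
        using class_average_strict_contraction[OF fin simple t(1,3), of "\<lambda>x. Im (v x)" "real_of_int k" x]
          q(2) v(1) by (simp add: q_def)
    next
      case False
      moreover have "(\<Sum>d\<in>?C. Re (v (d \<otimes> x))) = real_of_int k * Re (v x)" if "x \<in> ?D" for x
        using arg_cong[OF avg[OF that], of Re] k by simp
      moreover have "(\<Sum>x\<in>?D. Re (v x)) = 0" using arg_cong[OF v0, of Re] by simp
      ultimately show ?thesis
        using class_average_strict_contraction[OF fin simple t(1,3), of "\<lambda>x. Re (v x)" "real_of_int k" x]
          q(2) v(1) by (simp add: q_def)
    qed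
    then have "\<bar>k\<bar> < int q" by linarith
    then have "\<bar>k\<bar> < 3 ^ c" using q(1) by simp
    moreover have "int m * k = 3 ^ c * a"
    proof -
      have "(of_int (int m * k) :: complex) = of_int (3 ^ c * a)" using a k q(1) by simp
      then show ?thesis by (simp only: of_int_eq_iff)
    qed
    moreover have "int m * k\<^sup>2 = (3 ^ c)\<^sup>2 * b"
    proof -
      have "(of_int (int m * k\<^sup>2) :: complex) = of_int ((3 ^ c)\<^sup>2 * b)" using b k q(1) by simp
      then show ?thesis by (simp only: of_int_eq_iff)
    qed
    ultimately have "3 dvd a" using three_dvd_of_norm_less[of m k c a b] False k by simp
    then show ?thesis using a by (auto simp: m_def elim!: dvdE)
  qed (auto intro: exI[of _ 0])
  then obtain a where a: "\<And>l. l \<in> set ls \<Longrightarrow> of_nat (count_list ls l) * l = of_nat q * of_int (3 * a l)"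
    by metis
  \<comment> \<open>Index 0 is the first power: the trace of \<open>F\<close> is
    \<open>n * f \<one>\<close>, and \<open>f \<one> = - q / n\<close> because the identity is
    outside the class. All contributions to it being \<open>q\<close> times a multiple of 3,
    reduction modulo 3 gives the contradiction.\<close>
  have "- of_nat q = (\<Sum>l\<leftarrow>ls. l)"
    using tr[of 0] n one by (simp add: P_def F_def f_def)
  also have "\<dots> = (\<Sum>l\<in>set ls. of_nat (count_list ls l) * l)"
    by (rule sum_list_map_eq_sum_count_subset) auto
  also have "\<dots> = of_nat q * of_int (3 * (\<Sum>l\<in>set ls. a l))"
    using a by (simp add: sum_distrib_left)
  finally have eq: "- of_nat q = (of_nat q * of_int (3 * (\<Sum>l\<in>set ls. a l)) :: complex)" .
  have "of_nat q * (of_int (3 * (\<Sum>l\<in>set ls. a l)) + 1 :: complex) = 0"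
    by (simp only: distrib_left mult_1_right eq[symmetric]) simp
  then have "(of_int (3 * (\<Sum>l\<in>set ls. a l) + 1) :: complex) = 0"
    using q(2) by simp
  then have "3 * (\<Sum>l\<in>set ls. a l) + 1 = 0" by (simp only: of_int_eq_0_iff)
  then show False by presburger
qed

end

section \<open>Normal subgroups of prime power order\<close>

lemma even_card_involution_no_fixpoint:
  assumes "finite A" "\<And>x. x \<in> A \<Longrightarrow> f x \<in> A \<and> f x \<noteq> x \<and> f (f x) = x"
  shows "even (card A)"
  using assms
proof (induction A rule: finite_psubset_induct)
  case (psubset A)
  show ?case
  proof (cases "A = {}")
    case False
    then obtain x where x: "x \<in> A" by auto
    note fx = psubset.prems[OF x]
    have "even (card (A - {x, f x}))"
    proof (rule psubset.IH)
      show "A - {x, f x} \<subset> A" using x by auto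
      fix y assume "y \<in> A - {x, f x}"
      then have y: "y \<in> A" "y \<noteq> x" "y \<noteq> f x" by auto
      then have "f y \<noteq> x" "f y \<noteq> f x" using psubset.prems[OF y(1)] fx by metis+
      then show "f y \<in> A - {x, f x} \<and> f y \<noteq> y \<and> f (f y) = y" using psubset.prems[OF y(1)] by auto
    qed
    moreover have "card A = card (A - {x, f x}) + 2"
    proof -
      have "card (A - {x, f x}) = card A - card {x, f x}"
        using x fx by (intro card_Diff_subset) auto
      moreover have "card {x, f x} = 2" using fx by auto
      moreover have "card {x, f x} \<le> card A" using x fx psubset.hyps by (intro card_mono) auto
      ultimately show ?thesis by linarith
    qed
    ultimately show ?thesis by simp
  qed simp
qed

text \<open>Elements of \<open>BijGroup S\<close> are extensional, so an action given by total
  functions becomes a homomorphism only after restriction to \<open>S\<close>.\<close>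

lemma group_action_restrict:
  assumes "group H"
    and closed: "\<And>g x. g \<in> carrier H \<Longrightarrow> x \<in> S \<Longrightarrow> act g x \<in> S"
    and one: "\<And>x. x \<in> S \<Longrightarrow> act \<one>\<^bsub>H\<^esub> x = x"
    and mult: "\<And>g h x. g \<in> carrier H \<Longrightarrow> h \<in> carrier H \<Longrightarrow> x \<in> S \<Longrightarrow>
      act (g \<otimes>\<^bsub>H\<^esub> h) x = act g (act h x)"
  shows "group_action H S (\<lambda>g. \<lambda>x\<in>S. act g x)"
proof -
  interpret H: group H by fact
  have bij: "(\<lambda>x\<in>S. act g x) \<in> Bij S" if g: "g \<in> carrier H" for g
  proof -
    have "bij_betw (act g) S S"
    proof (rule bij_betwI[where g = "act (inv\<^bsub>H\<^esub> g)"])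
      fix x assume x: "x \<in> S"
      show "act (inv\<^bsub>H\<^esub> g) (act g x) = x" "act g (act (inv\<^bsub>H\<^esub> g) x) = x"
        using x g mult[of "inv\<^bsub>H\<^esub> g" g x] mult[of g "inv\<^bsub>H\<^esub> g" x] one by simp_all
    qed (use closed g in auto)
    then have "bij_betw (\<lambda>x\<in>S. act g x) S S" by (simp cong: bij_betw_cong)
    then show ?thesis by (simp add: Bij_def)
  qed
  show ?thesis
    unfolding group_action_def group_hom_def group_hom_axioms_def
  proof (intro conjI homI)
    show "(\<lambda>x\<in>S. act g x) \<in> carrier (BijGroup S)" if "g \<in> carrier H" for g
      using bij[OF that] by (simp add: BijGroup_def)
    show "(\<lambda>x\<in>S. act (g \<otimes>\<^bsub>H\<^esub> h) x) = (\<lambda>x\<in>S. act g x) \<otimes>\<^bsub>BijGroup S\<^esub> (\<lambda>x\<in>S. act h x)"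
      if "g \<in> carrier H" "h \<in> carrier H" for g h
      using bij that closed mult by (auto simp: BijGroup_def compose_def restrict_def)
  qed (use \<open>group H\<close> group_BijGroup in auto)
qed

text \<open>The points that are not fixed split into orbits whose sizes divide \<open>p ^ k\<close>
  and exceed 1. Hence \<open>card S\<close> and the number of fixed points differ by a multiple of
  \<open>p\<close>.\<close>

lemma p_group_card_fixed_points:
  assumes "group H" and p: "Factorial_Ring.prime p" "card (carrier H) = p ^ k" and S: "finite S"
    and closed: "\<And>g x. g \<in> carrier H \<Longrightarrow> x \<in> S \<Longrightarrow> act g x \<in> S"
    and one: "\<And>x. x \<in> S \<Longrightarrow> act \<one>\<^bsub>H\<^esub> x = x"
    and mult: "\<And>g h x. g \<in> carrier H \<Longrightarrow> h \<in> carrier H \<Longrightarrow> x \<in> S \<Longrightarrow>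
      act (g \<otimes>\<^bsub>H\<^esub> h) x = act g (act h x)"
  shows "p dvd card S \<longleftrightarrow> p dvd card {x \<in> S. \<forall>g\<in>carrier H. act g x = x}"
proof -
  define \<phi> where "\<phi> = (\<lambda>g. \<lambda>x\<in>S. act g x)"
  interpret group_action H S \<phi>
    unfolding \<phi>_def using assms by (intro group_action_restrict) auto
  let ?Fix = "{x \<in> S. \<forall>g\<in>carrier H. act g x = x}"
  let ?O = "orbit H \<phi> ` (S - ?Fix)"
  have orb: "orbit H \<phi> x \<subseteq> S" "x \<in> orbit H \<phi> x" if "x \<in> S" for x
    using that element_image orbit_refl by (auto simp: orbit_def)
  have sym: "orbit H \<phi> y = orbit H \<phi> x" if "x \<in> S" "y \<in> orbit H \<phi> x" for x y
    using that orb by (meson orbit_sym orbit_trans subset_antisym subset_eq)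
  have "\<Union>?O = S - ?Fix"
  proof
    show "\<Union>?O \<subseteq> S - ?Fix"
    proof
      fix y assume "y \<in> \<Union>?O"
      then obtain x where x: "x \<in> S" "x \<notin> ?Fix" "y \<in> orbit H \<phi> x" by auto
      have "y \<in> S" using x orb by auto
      moreover have "y \<notin> ?Fix"
      proof
        assume "y \<in> ?Fix"
        then have "orbit H \<phi> y \<subseteq> {y}" by (auto simp: orbit_def \<phi>_def)
        moreover have "orbit H \<phi> y = orbit H \<phi> x" using sym x by auto
        ultimately have "x = y" using orb(2)[OF x(1)] by auto
        then show False using x(2) \<open>y \<in> ?Fix\<close> by auto
      qed
      ultimately show "y \<in> S - ?Fix" by auto
    qed
    show "S - ?Fix \<subseteq> \<Union>?O" using orb(2) by blast
  qed
  moreover have "p dvd card (\<Union>?O)"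
  proof (rule dvd_partition)
    show "finite (\<Union>?O)" using S \<open>\<Union>?O = S - ?Fix\<close> by simp
    show "\<forall>c\<in>?O. p dvd card c"
    proof
      fix c assume "c \<in> ?O"
      then obtain x where x: "x \<in> S" "x \<notin> ?Fix" "c = orbit H \<phi> x" by auto
      have "card c dvd p ^ k"
        using orbit_stabilizer_theorem[OF x(1)] p x(3)
        by (metis dvd_triv_left Coset.order_def)
      then obtain i where i: "card c = p ^ i"
        using divides_primepow_nat[OF p(1)] by blast
      have "i \<noteq> 0"
      proof
        assume "i = 0"
        then obtain z where "c = {z}" using i card_1_singletonE by auto
        then have "\<phi> g x = x" if "g \<in> carrier H" for g
          using that x orb(2)[OF x(1)] by (auto simp: orbit_def)
        then have "act g x = x" if "g \<in> carrier H" for g using that x(1) by (auto simp: \<phi>_def)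
        then show False using x(1,2) by auto
      qed
      then show "p dvd card c" using i by simp
    qed
    show "\<forall>c1\<in>?O. \<forall>c2\<in>?O. c1 \<noteq> c2 \<longrightarrow> c1 \<inter> c2 = {}"
    proof (intro ballI impI)
      fix c1 c2 assume "c1 \<in> ?O" "c2 \<in> ?O" and ne: "c1 \<noteq> c2"
      then obtain x y where xy: "x \<in> S" "c1 = orbit H \<phi> x" "y \<in> S" "c2 = orbit H \<phi> y" by auto
      then show "c1 \<inter> c2 = {}" using sym ne by (metis disjoint_iff)
    qed
  qed
  moreover have "card S = card ?Fix + card (S - ?Fix)"
    using S by (subst card_Un_disjoint[symmetric]) (auto intro: arg_cong[of _ _ card])
  ultimately show ?thesis by (simp add: dvd_add_left_iff)
qed

section \<open>Class sizes and involutions\<close>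

context group
begin

lemma card_conj_class_dvd:
  assumes t: "t \<in> carrier G"
  shows "card (conj_class t) dvd card (carrier G)"
proof -
  have "group_action G (carrier G) (\<lambda>g. \<lambda>h\<in>carrier G. g \<otimes> h \<otimes> inv g)"
    by (intro group_action_restrict) (auto simp: m_assoc inv_mult_group group_axioms)
  from group_action.orbit_stabilizer_theorem[OF this t]
  have "card (orbit G (\<lambda>g. \<lambda>h\<in>carrier G. g \<otimes> h \<otimes> inv g) t) dvd card (carrier G)"
    unfolding Coset.order_def by (rule dvdI[OF sym])
  moreover have "orbit G (\<lambda>g. \<lambda>h\<in>carrier G. g \<otimes> h \<otimes> inv g) t = conj_class t"
    using t by (auto simp: orbit_def conj_class_def)
  ultimately show ?thesis by simp
qed

lemma conj_class_eq:
  assumes "t \<in> carrier G" "c \<in> conj_class t"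
  shows "conj_class c = conj_class t"
proof
  have c: "c \<in> carrier G" using assms conj_class_subset by auto
  obtain g where g: "g \<in> carrier G" "c = g \<otimes> t \<otimes> inv g" using assms by (auto simp: conj_class_def)
  then have "t = inv g \<otimes> c \<otimes> inv (inv g)" using assms by (simp add: m_assoc)
  then have t: "t \<in> conj_class c" using g unfolding conj_class_def by blast
  show "conj_class c \<subseteq> conj_class t"
    using conj_class_conj[OF assms] by (auto simp: conj_class_def[of c])
  show "conj_class t \<subseteq> conj_class c"
    using conj_class_conj[OF c t] by (auto simp: conj_class_def[of t])
qed

text \<open>Inversion pairs off the elements whose square is not \<open>\<one>\<close>, so a group
  of even order has an odd number of involutions. These are partitioned into conjugacy classes, not
  all of which can be even.\<close>

lemma exists_involution_odd_class:
  assumes fin: "finite (carrier G)" and even: "even (card (carrier G))"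
  obtains t where "t \<in> carrier G" "t \<noteq> \<one>" "t \<otimes> t = \<one>" "odd (card (conj_class t))"
proof -
  define I where "I = {x \<in> carrier G. x \<noteq> \<one> \<and> x \<otimes> x = \<one>}"
  have inv_eq: "inv x = x \<longleftrightarrow> x \<otimes> x = \<one>" if "x \<in> carrier G" for x
    using that by (metis inv_equality r_inv)
  have finI: "finite I" using fin by (simp add: I_def)
  have "even (card (carrier G - (I \<union> {\<one>})))"
  proof (rule even_card_involution_no_fixpoint[where f = "\<lambda>x. inv x"])
    fix x assume "x \<in> carrier G - (I \<union> {\<one>})"
    then have x: "x \<in> carrier G" "x \<noteq> \<one>" "x \<otimes> x \<noteq> \<one>" by (auto simp: I_def)
    then have "inv x \<otimes> inv x \<noteq> \<one>" using inv_eq[of "inv x"] inv_eq[of x] by auto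
    then show "inv x \<in> carrier G - (I \<union> {\<one>}) \<and> inv x \<noteq> x \<and> inv (inv x) = x"
      using x inv_eq by (auto simp: I_def)
  qed (use fin in auto)
  moreover have "card (carrier G) = card (carrier G - (I \<union> {\<one>})) + card (I \<union> {\<one>})"
  proof -
    have sub: "I \<union> {\<one>} \<subseteq> carrier G" by (auto simp: I_def)
    show ?thesis
      using card_Diff_subset[OF finite_subset[OF sub fin] sub] card_mono[OF fin sub] by linarith
  qed
  moreover have "card (I \<union> {\<one>}) = card I + 1" using finI by (simp add: I_def)
  ultimately have odd: "odd (card I)" using even by simp
  have "\<exists>t\<in>I. odd (card (conj_class t))"
  proof (rule ccontr)
    assume no: "\<not> ?thesis"
    have conj_I: "conj_class t \<subseteq> I" if "t \<in> I" for t
    proof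
      fix c assume c: "c \<in> conj_class t"
      have t: "t \<in> carrier G" "t \<noteq> \<one>" "t \<otimes> t = \<one>" using that by (auto simp: I_def)
      have "c \<noteq> \<one>"
      proof
        assume "c = \<one>"
        then have "conj_class \<one> = conj_class t" using conj_class_eq[OF t(1)] c by simp
        moreover have "conj_class \<one> = {\<one>}" by (auto simp: conj_class_def)
        ultimately show False using self_in_conj_class[OF t(1)] t(2) by auto
      qed
      then show "c \<in> I"
        using conj_class_involution(1)[OF t(1,3) c] conj_class_subset[OF t(1)] c by (auto simp: I_def)
    qed
    have U: "\<Union>(conj_class ` I) = I"
      using conj_I self_in_conj_class by (auto simp: I_def)
    have "2 dvd card (\<Union>(conj_class ` I))"
    proof (rule dvd_partition)
      show "finite (\<Union>(conj_class ` I))" using U finI by simp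
      show "\<forall>c\<in>conj_class ` I. 2 dvd card c" using no by auto
      show "\<forall>c1\<in>conj_class ` I. \<forall>c2\<in>conj_class ` I. c1 \<noteq> c2 \<longrightarrow> c1 \<inter> c2 = {}"
      proof (intro ballI impI)
        fix c1 c2 assume "c1 \<in> conj_class ` I" "c2 \<in> conj_class ` I" and ne: "c1 \<noteq> c2"
        then obtain x y where xy: "x \<in> carrier G" "c1 = conj_class x" "y \<in> carrier G" "c2 = conj_class y"
          by (auto simp: I_def)
        then show "c1 \<inter> c2 = {}" using conj_class_eq ne by (metis disjoint_iff)
      qed
    qed
    then show False using U odd by simp
  qed
  then show ?thesis using that by (auto simp: I_def)
qed

section \<open>Products of normal p-subgroups\<close>

text \<open>The fibre of multiplication over \<open>h \<otimes> k\<close> consists of the pairs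
  \<open>(h \<otimes> u, inv u \<otimes> k)\<close> with \<open>u\<close> in the
  intersection.\<close>

lemma card_set_mult:
  assumes H: "subgroup H G" and K: "subgroup K G" and fin: "finite H" "finite K"
  shows "card (H <#> K) * card (H \<inter> K) = card H * card K"
proof -
  let ?m = "\<lambda>(h, k). h \<otimes> k"
  have HK: "h \<in> carrier G" if "h \<in> H \<or> h \<in> K" for h
    using that H K by (auto dest: subgroup.mem_carrier)
  have im: "?m ` (H \<times> K) = H <#> K" by (auto simp: set_mult_def)
  have fiber: "card {p \<in> H \<times> K. ?m p = x} = card (H \<inter> K)" if "x \<in> H <#> K" for x
  proof -
    obtain h k where hk: "h \<in> H" "k \<in> K" "x = h \<otimes> k" using \<open>x \<in> H <#> K\<close> by (auto simp: set_mult_def)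
    have "bij_betw (\<lambda>u. (h \<otimes> u, inv u \<otimes> k)) (H \<inter> K) {p \<in> H \<times> K. ?m p = x}"
    proof (rule bij_betwI[where g = "\<lambda>p. inv h \<otimes> fst p"])
      show "(\<lambda>u. (h \<otimes> u, inv u \<otimes> k)) \<in> H \<inter> K \<rightarrow> {p \<in> H \<times> K. ?m p = x}"
        using hk HK H K by (auto simp: m_assoc subgroup.m_closed subgroup.m_inv_closed)
      show "(\<lambda>p. inv h \<otimes> fst p) \<in> {p \<in> H \<times> K. ?m p = x} \<rightarrow> H \<inter> K"
      proof
        fix p assume "p \<in> {p \<in> H \<times> K. ?m p = x}"
        then obtain a b where ab: "p = (a, b)" "a \<in> H" "b \<in> K" "a \<otimes> b = h \<otimes> k"
          using hk by (cases p) auto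
        have "inv h \<otimes> a \<in> H" using ab hk H by (simp add: subgroup.m_closed subgroup.m_inv_closed)
        moreover have "inv h \<otimes> a = k \<otimes> inv b"
        proof -
          have "inv h \<otimes> a = inv h \<otimes> (a \<otimes> b) \<otimes> inv b" using ab(2,3) hk HK by (simp add: m_assoc)
          also have "\<dots> = k \<otimes> inv b" unfolding ab(4) using ab hk HK by simp
          finally show ?thesis .
        qed
        then have "inv h \<otimes> a \<in> K" using ab hk K by (simp add: subgroup.m_closed subgroup.m_inv_closed)
        ultimately show "inv h \<otimes> fst p \<in> H \<inter> K" using ab(1) by simp
      qed
      show "inv h \<otimes> fst (h \<otimes> u, inv u \<otimes> k) = u" if "u \<in> H \<inter> K" for u using that hk HK by simp
      show "(h \<otimes> (inv h \<otimes> fst p), inv (inv h \<otimes> fst p) \<otimes> k) = p" if mem: "p \<in> {p \<in> H \<times> K. ?m p = x}" for p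
      proof -
        obtain a b where p: "p = (a, b)" "a \<in> H" "b \<in> K" "a \<otimes> b = h \<otimes> k" using mem hk by (cases p) auto
        have "inv (inv h \<otimes> a) \<otimes> k = inv a \<otimes> (h \<otimes> k)"
          using p hk HK by (simp add: inv_mult_group m_assoc)
        also have "\<dots> = b" using p HK by (simp flip: p(4))
        finally show ?thesis using p hk HK by simp
      qed
    qed
    then show ?thesis by (simp add: bij_betw_same_card)
  qed
  have "card H * card K = (\<Sum>p\<in>H \<times> K. 1)" by (simp add: card_cartesian_product)
  also have "\<dots> = (\<Sum>x\<in>?m ` (H \<times> K). \<Sum>p\<in>{p \<in> H \<times> K. ?m p = x}. 1)"
    by (rule sum.image_gen) (use fin in auto)
  also have "\<dots> = card (H <#> K) * card (H \<inter> K)"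
    unfolding im using fiber by simp
  finally show ?thesis by simp
qed

text \<open>A product of two normal p-subgroups of \<open>N\<close> is again one, so a largest one,
  \<open>R\<close>, absorbs all others. Every conjugate of \<open>R\<close> under \<open>G\<close>
  is such a subgroup of \<open>N\<close>, hence lies in \<open>R\<close>. Being at least as large as
  \<open>Q\<close>, \<open>R\<close> is nontrivial.\<close>

lemma normal_p_subgroup_of_normal:
  assumes fin: "finite (carrier G)" and p: "Factorial_Ring.prime p" and N: "N \<lhd> G"
    and Q: "Q \<lhd> (G\<lparr>carrier := N\<rparr>)" "Q \<noteq> {\<one>}" "card Q = p ^ k"
  shows "\<exists>R j. R \<lhd> G \<and> R \<noteq> {\<one>} \<and> card R = p ^ j"
proof -
  have subN: "subgroup N G" using N by (rule normal_imp_subgroup)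
  have NG: "n \<in> carrier G" if "n \<in> N" for n using subgroup.mem_carrier[OF subN that] .
  have finN: "finite N" using fin NG by (meson finite_subset subsetI)
  \<comment> \<open>These are the normal p-subgroups of \<open>N\<close>, described by the
    operations of \<open>G\<close> so that elements outside \<open>N\<close> can conjugate
    them.\<close>
  define good where "good R \<longleftrightarrow> subgroup R G \<and> R \<subseteq> N \<and> (\<forall>n\<in>N. \<forall>r\<in>R. n \<otimes> r \<otimes> inv n \<in> R) \<and>
      (\<exists>j. card R = p ^ j)" for R
  have prodI: "a \<otimes> b \<in> A <#> B" if "a \<in> A" "b \<in> B" for a b A B
    using that by (auto simp: set_mult_def)
  have goodQ: "good Q"
  proof -
    have sub: "subgroup Q (G\<lparr>carrier := N\<rparr>)" using Q(1) by (rule normal_imp_subgroup)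
    have "Q \<subseteq> N" using subgroup.subset[OF sub] by simp
    moreover have "subgroup Q G" using incl_subgroup[OF subN sub] .
    moreover have "n \<otimes> r \<otimes> inv n \<in> Q" if "n \<in> N" "r \<in> Q" for n r
      using normal.inv_op_closed2[OF Q(1), of n r] that m_inv_consistent[OF subN that(1)] by simp
    ultimately show ?thesis using Q(3) by (auto simp: good_def)
  qed
  have good_prod: "good (A <#> B)" if A: "good A" and B: "good B" for A B
  proof -
    have sA: "subgroup A G" and sB: "subgroup B G" using A B by (auto simp: good_def)
    have AN: "A \<subseteq> N" and BN: "B \<subseteq> N" using A B by (auto simp: good_def)
    have AG: "a \<in> carrier G" if "a \<in> A" for a using subgroup.mem_carrier[OF sA that] .
    have BG: "b \<in> carrier G" if "b \<in> B" for b using subgroup.mem_carrier[OF sB that] .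
    have conjA: "n \<otimes> r \<otimes> inv n \<in> A" if "n \<in> N" "r \<in> A" for n r using that A by (auto simp: good_def)
    have conjB: "n \<otimes> r \<otimes> inv n \<in> B" if "n \<in> N" "r \<in> B" for n r using that B by (auto simp: good_def)
    have memE: "\<exists>a b. a \<in> A \<and> b \<in> B \<and> z = a \<otimes> b" if "z \<in> A <#> B" for z
      using that by (auto simp: set_mult_def)
    have "subgroup (A <#> B) G"
    proof (rule subgroupI)
      show "A <#> B \<subseteq> carrier G" using AG BG by (auto simp: set_mult_def)
      show "A <#> B \<noteq> {}"
        using prodI[OF subgroup.one_closed[OF sA] subgroup.one_closed[OF sB]] by auto
      fix y assume "y \<in> A <#> B"
      then obtain a b where ab: "a \<in> A" "b \<in> B" "y = a \<otimes> b" using memE by blast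
      have "inv a \<in> A" "inv b \<in> B" using ab sA sB by (auto simp: subgroup.m_inv_closed)
      then have "a \<otimes> inv b \<otimes> inv a \<in> B" using conjB ab AN by auto
      then have "inv a \<otimes> (a \<otimes> inv b \<otimes> inv a) \<in> A <#> B" using prodI \<open>inv a \<in> A\<close> by auto
      then show "inv y \<in> A <#> B" using ab AG BG by (simp add: inv_mult_group m_assoc)
      fix z assume "z \<in> A <#> B"
      then obtain c d where cd: "c \<in> A" "d \<in> B" "z = c \<otimes> d" using memE by blast
      have "inv c \<in> N" using subgroup.m_inv_closed[OF sA cd(1)] AN by auto
      then have "inv c \<otimes> b \<otimes> inv (inv c) \<in> B" using conjB ab(2) by blast
      \<comment> \<open>The product of \<open>a \<otimes> b\<close> and \<open>c \<otimes> d\<close>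
        is rewritten by moving \<open>c\<close> to the left past \<open>b\<close>, which conjugates
        \<open>b\<close> inside \<open>B\<close>.\<close>
      then have "(a \<otimes> c) \<otimes> ((inv c \<otimes> b \<otimes> inv (inv c)) \<otimes> d) \<in> A <#> B"
        using prodI sA sB ab cd by (auto simp: subgroup.m_closed)
      then show "y \<otimes> z \<in> A <#> B" using ab cd AG BG by (simp add: m_assoc)
    qed
    moreover have "A <#> B \<subseteq> N"
      using AN BN subgroup.m_closed[OF subN] by (auto simp: set_mult_def)
    moreover have "n \<otimes> r \<otimes> inv n \<in> A <#> B" if n: "n \<in> N" and r: "r \<in> A <#> B" for n r
    proof -
      obtain a b where ab: "a \<in> A" "b \<in> B" "r = a \<otimes> b" using memE r by blast
      have "n \<otimes> r \<otimes> inv n = (n \<otimes> a \<otimes> inv n) \<otimes> (n \<otimes> b \<otimes> inv n)"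
        using ab AG BG NG[OF n] by (simp add: m_assoc)
      then show ?thesis using prodI conjA conjB ab n by auto
    qed
    moreover have "\<exists>j. card (A <#> B) = p ^ j"
    proof -
      obtain i j where ij: "card A = p ^ i" "card B = p ^ j" using A B by (auto simp: good_def)
      have "card (A <#> B) dvd p ^ (i + j)"
        using card_set_mult[OF sA sB] finite_subset[OF AN finN] finite_subset[OF BN finN] ij
        by (metis dvd_triv_left power_add)
      then show ?thesis using divides_primepow_nat[OF p] by blast
    qed
    ultimately show ?thesis by (auto simp: good_def)
  qed
  have bound: "\<forall>R. good R \<longrightarrow> card R < Suc (card N)"
    using card_mono[OF finN] by (auto simp: good_def le_imp_less_Suc)
  obtain R where R: "good R" "\<And>R'. good R' \<Longrightarrow> card R' \<le> card R"
    using ex_has_greatest_nat[OF goodQ bound] by auto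
  have sR: "subgroup R G" and RN: "R \<subseteq> N" using R(1) by (auto simp: good_def)
  have RG: "r \<in> carrier G" if "r \<in> R" for r using subgroup.mem_carrier[OF sR that] .
  have "R \<lhd> G"
  proof (rule normal_invI[OF sR])
    fix g r assume g: "g \<in> carrier G" and r: "r \<in> R"
    let ?S = "(\<lambda>r. g \<otimes> r \<otimes> inv g) ` R"
    have "good ?S" unfolding good_def
    proof (intro conjI ballI)
      show "subgroup ?S G"
      proof (rule subgroupI)
        show "?S \<subseteq> carrier G" using g RG by auto
        show "?S \<noteq> {}" using r by auto
        fix y assume "y \<in> ?S"
        then obtain a where a: "a \<in> R" "y = g \<otimes> a \<otimes> inv g" by auto
        have "inv y = g \<otimes> inv a \<otimes> inv g" using a RG g by (simp add: inv_mult_group m_assoc)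
        then show "inv y \<in> ?S" using a subgroup.m_inv_closed[OF sR] by auto
        fix z assume "z \<in> ?S"
        then obtain b where b: "b \<in> R" "z = g \<otimes> b \<otimes> inv g" by auto
        have "y \<otimes> z = g \<otimes> (a \<otimes> b) \<otimes> inv g" using a b RG g by (simp add: m_assoc)
        then show "y \<otimes> z \<in> ?S" using a b subgroup.m_closed[OF sR] by auto
      qed
      show "?S \<subseteq> N" using RN g normal.inv_op_closed2[OF N] by auto
      fix n s assume n: "n \<in> N" and "s \<in> ?S"
      then obtain a where a: "a \<in> R" "s = g \<otimes> a \<otimes> inv g" by auto
      have n': "inv g \<otimes> n \<otimes> g \<in> N" using normal.inv_op_closed1[OF N g n] .
      then have "(inv g \<otimes> n \<otimes> g) \<otimes> a \<otimes> inv (inv g \<otimes> n \<otimes> g) \<in> R"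
        using R(1) a by (auto simp: good_def)
      moreover have "n \<otimes> s \<otimes> inv n = g \<otimes> ((inv g \<otimes> n \<otimes> g) \<otimes> a \<otimes> inv (inv g \<otimes> n \<otimes> g)) \<otimes> inv g"
        using a RG g NG[OF n] by (simp add: inv_mult_group m_assoc)
      ultimately show "n \<otimes> s \<otimes> inv n \<in> ?S" by auto
    next
      have "inj_on (\<lambda>r. g \<otimes> r \<otimes> inv g) R" using g RG by (auto intro!: inj_onI)
      then show "\<exists>j. card ?S = p ^ j" using R(1) by (auto simp: good_def card_image)
    qed
    then have good: "good (R <#> ?S)" using good_prod R(1) by blast
    then have "finite (R <#> ?S)" using finite_subset[OF _ finN] by (auto simp: good_def)
    moreover have "R \<subseteq> R <#> ?S"
    proof
      fix a assume a: "a \<in> R"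
      have "\<one> = g \<otimes> \<one> \<otimes> inv g" using g by simp
      then have "\<one> \<in> ?S" using subgroup.one_closed[OF sR] by blast
      then have "a \<otimes> \<one> \<in> R <#> ?S" by (rule prodI[OF a])
      then show "a \<in> R <#> ?S" using RG[OF a] by simp
    qed
    ultimately have "R = R <#> ?S" using R(2)[OF good] by (intro card_seteq) auto
    moreover have "\<one> \<otimes> (g \<otimes> r \<otimes> inv g) \<in> R <#> ?S"
      using r subgroup.one_closed[OF sR] by (intro prodI) auto
    ultimately show "g \<otimes> r \<otimes> inv g \<in> R" using g RG[OF r] by simp
  qed
  moreover have "R \<noteq> {\<one>}"
  proof
    assume "R = {\<one>}"
    then have "card Q \<le> 1" using R(2)[OF goodQ] by simp
    moreover have "\<one> \<in> Q" using goodQ subgroup.one_closed by (auto simp: good_def)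
    moreover have "finite Q" using finite_subset[OF _ finN] goodQ by (auto simp: good_def)
    ultimately have "Q = {\<one>}" by (auto simp: card_le_Suc0_iff_eq)
    then show False using Q(2) by simp
  qed
  ultimately show ?thesis using R(1) by (auto simp: good_def)
qed

end

section \<open>Groups whose order has only the prime divisors 2 and 3\<close>

lemma dvd_two_three_power:
  assumes "(x::nat) dvd 2 ^ a * 3 ^ b"
  obtains i j where "x = 2 ^ i * 3 ^ j"
proof -
  obtain y z where yz: "x = y * z" "y dvd 2 ^ a" "z dvd 3 ^ b"
    using division_decomp[OF assms] by blast
  obtain i where "y = 2 ^ i" using divides_primepow_nat[of 2 y a] yz by auto
  moreover obtain j where "z = 3 ^ j" using divides_primepow_nat[of 3 z b] yz by auto
  ultimately show ?thesis using that yz(1) by blast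
qed

text \<open>A proper nontrivial normal subgroup yields the claim through \<open>IH\<close>.
  Otherwise either \<open>G\<close> itself is a 3-group, or some involution \<open>t\<close> has a
  class of odd size \<open>3 ^ c\<close>. The case \<open>c > 0\<close> is impossible by the
  eigenvalue argument, and \<open>c = 0\<close> makes \<open>t\<close> central, so that
  \<open>{\<one>, t}\<close> is normal.\<close>

lemma (in group) two_three_group_normal_p_subgroup_step:
  assumes fin: "finite (carrier G)" and nontriv: "carrier G \<noteq> {\<one>}"
    and card: "card (carrier G) = 2 ^ a * 3 ^ b"
    and IH: "\<And>N. N \<lhd> G \<Longrightarrow> N \<noteq> {\<one>} \<Longrightarrow> N \<noteq> carrier G \<Longrightarrow>
      \<exists>p\<in>{2, 3}. \<exists>Q k. Q \<lhd> (G\<lparr>carrier := N\<rparr>) \<and> Q \<noteq> {\<one>} \<and> card Q = p ^ k"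
  shows "\<exists>p\<in>{2, 3}. \<exists>N k. N \<lhd> G \<and> N \<noteq> {\<one>} \<and> card N = p ^ k"
proof (cases "\<forall>N. N \<lhd> G \<longrightarrow> N = {\<one>} \<or> N = carrier G")
  case False
  then obtain N where N: "N \<lhd> G" "N \<noteq> {\<one>}" "N \<noteq> carrier G" by auto
  obtain p Q k where Q: "p \<in> {2, 3}" "Q \<lhd> (G\<lparr>carrier := N\<rparr>)" "Q \<noteq> {\<one>}" "card Q = p ^ k"
    using IH[OF N] by blast
  have "Factorial_Ring.prime p" using Q(1) by auto
  from normal_p_subgroup_of_normal[OF fin this N(1) Q(2,3,4)] show ?thesis using Q(1) by blast
next
  case True
  then have simple: "N = {\<one>} \<or> N = carrier G" if "N \<lhd> G" for N using that by blast
  show ?thesis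
  proof (cases "a = 0")
    case True
    have "carrier G \<lhd> G" by (rule normal_invI[OF subgroup_self]) auto
    then show ?thesis using True nontriv card by auto
  next
    case False
    then have "even (card (carrier G))" using card by simp
    then obtain t where t: "t \<in> carrier G" "t \<noteq> \<one>" "t \<otimes> t = \<one>" "odd (card (conj_class t))"
      using exists_involution_odd_class[OF fin] by blast
    have "card (conj_class t) dvd 2 ^ a * 3 ^ b"
      using card_conj_class_dvd[OF t(1)] card by simp
    then obtain i c where ic: "card (conj_class t) = 2 ^ i * 3 ^ c" by (rule dvd_two_three_power)
    then have c: "card (conj_class t) = 3 ^ c" using t(4) by (cases i) auto
    show ?thesis
    proof (cases "c = 0")
      case False
      then show ?thesis using simple_involution_class_not_three_power[OF fin simple t(1-3) c] by blast
    next
      case True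
      then obtain z where "conj_class t = {z}" using c card_1_singletonE by auto
      then have central: "g \<otimes> t \<otimes> inv g = t" if "g \<in> carrier G" for g
        using self_in_conj_class[OF t(1)] conj_class_conj[OF t(1) self_in_conj_class[OF t(1)] that] by auto
      have inv_t: "inv t = t" using t inv_equality by auto
      have "{\<one>, t} \<lhd> G"
      proof (rule normal_invI)
        show "subgroup {\<one>, t} G" by (rule subgroupI) (use t inv_t in auto)
      qed (use central in auto)
      moreover have "card {\<one>, t} = 2 ^ 1" "{\<one>, t} \<noteq> {\<one>}" using t(2) by auto
      ultimately show ?thesis by blast
    qed
  qed
qed

text \<open>The case \<open>{p, q} = {2, 3}\<close> of Burnside's theorem.\<close>

theorem two_three_group_normal_p_subgroup:
  fixes G :: "('a, 'b) monoid_scheme"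
  assumes "group G" "finite (carrier G)" "carrier G \<noteq> {\<one>\<^bsub>G\<^esub>}" "card (carrier G) = 2 ^ a * 3 ^ b"
  shows "\<exists>p\<in>{2, 3}. \<exists>N k. N \<lhd> G \<and> N \<noteq> {\<one>\<^bsub>G\<^esub>} \<and> card N = p ^ k"
  using assms
proof (induction "card (carrier G)" arbitrary: G a b rule: less_induct)
  case less
  interpret group G by fact
  show ?case
  proof (rule two_three_group_normal_p_subgroup_step[OF less.prems(2-4)])
    fix N assume N: "N \<lhd> G" "N \<noteq> {\<one>\<^bsub>G\<^esub>}" "N \<noteq> carrier G"
    have subN: "subgroup N G" using N(1) by (rule normal_imp_subgroup)
    have sub: "N \<subseteq> carrier G" using subgroup.subset[OF subN] .
    have "card N dvd card (carrier G)"
      using lagrange[OF subN] unfolding Coset.order_def by (metis dvd_triv_right)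
    then obtain i j where ij: "card N = 2 ^ i * 3 ^ j"
      unfolding less.prems(4) by (rule dvd_two_three_power)
    have "card N < card (carrier G)" using N(3) sub less.prems(2) by (intro psubset_card_mono) auto
    then show "\<exists>p\<in>{2, 3}. \<exists>Q k. Q \<lhd> (G\<lparr>carrier := N\<rparr>) \<and> Q \<noteq> {\<one>\<^bsub>G\<^esub>} \<and> card Q = p ^ k"
      using less.hyps[of "G\<lparr>carrier := N\<rparr>" i j] subgroup_imp_group[OF subN]
        finite_subset[OF sub less.prems(2)] N(2) ij by simp
  qed
qed

section \<open>Elementary abelian normal subgroups\<close>

context group
begin

lemma conj_nat_pow:
  assumes "g \<in> carrier G" "x \<in> carrier G"
  shows "(g \<otimes> x \<otimes> inv g) [^] (n::nat) = g \<otimes> x [^] n \<otimes> inv g"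
  using assms by (induction n) (simp_all add: m_assoc)

text \<open>\<open>Z\<close> consists of the elements of the centre of \<open>N\<close> whose
  \<open>p\<close>-th power is \<open>\<one>\<close>. The centre is nontrivial by counting fixed
  points of conjugation, and both conditions are preserved by conjugation with elements of
  \<open>G\<close>.\<close>

lemma normal_elementary_abelian_subgroup:
  assumes fin: "finite (carrier G)" and p: "Factorial_Ring.prime p" and N: "N \<lhd> G" "N \<noteq> {\<one>}" "card N = p ^ k"
  obtains Z where "Z \<lhd> G" "Z \<noteq> {\<one>}" "\<And>x y. x \<in> Z \<Longrightarrow> y \<in> Z \<Longrightarrow> x \<otimes> y = y \<otimes> x"
    "\<And>x. x \<in> Z \<Longrightarrow> x [^] p = \<one>"
proof -
  have subN: "subgroup N G" using N(1) by (rule normal_imp_subgroup)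
  have NG: "n \<in> carrier G" if "n \<in> N" for n using subgroup.mem_carrier[OF subN that] .
  have finN: "finite N" using fin NG by (meson finite_subset subsetI)
  \<comment> \<open>The centre of \<open>N\<close>, written as the fixed points of conjugation so
    that \<open>p_group_card_fixed_points\<close> applies directly.\<close>
  define C where "C = {x \<in> N. \<forall>n\<in>N. n \<otimes> x \<otimes> inv n = x}"
  have commute: "n \<otimes> x = x \<otimes> n" if "x \<in> C" "n \<in> N" for n x
  proof -
    have "n \<otimes> x \<otimes> inv n \<otimes> n = x \<otimes> n" using that by (auto simp: C_def)
    then show ?thesis using that NG by (simp add: C_def m_assoc)
  qed
  have commuteI: "x \<in> C" if "x \<in> N" "\<And>n. n \<in> N \<Longrightarrow> n \<otimes> x = x \<otimes> n" for x
    using that NG by (auto simp: C_def m_assoc)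
  have k: "k \<noteq> 0"
  proof
    assume "k = 0"
    then obtain z where "N = {z}" using N(3) card_1_singletonE by auto
    then show False using N(2) subgroup.one_closed[OF subN] by auto
  qed
  have "p dvd card {x \<in> N. \<forall>n\<in>carrier (G\<lparr>carrier := N\<rparr>). n \<otimes> x \<otimes> inv n = x}"
  proof (subst p_group_card_fixed_points[symmetric, where H = "G\<lparr>carrier := N\<rparr>" and p = p and k = k])
    show "group (G\<lparr>carrier := N\<rparr>)" using subgroup_imp_group[OF subN] .
    show "p dvd card N" using k N(3) by simp
    fix g x assume "g \<in> carrier (G\<lparr>carrier := N\<rparr>)" "x \<in> N"
    then show "g \<otimes> x \<otimes> inv g \<in> N" using subN by (simp add: subgroup.m_closed subgroup.m_inv_closed)
  qed (use p N finN NG in \<open>auto simp: m_assoc inv_mult_group\<close>)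
  then have "p dvd card C" by (simp add: C_def)
  moreover have "\<one> \<in> C" using subgroup.one_closed[OF subN] NG by (simp add: C_def)
  moreover have "finite C" using finN by (simp add: C_def)
  ultimately have "\<exists>x\<in>C. x \<noteq> \<one>"
  proof -
    have "card C \<noteq> 1" using \<open>p dvd card C\<close> p by (auto dest: not_prime_unit)
    then show ?thesis using \<open>\<one> \<in> C\<close> by (metis is_singletonI' is_singleton_altdef empty_iff)
  qed
  then obtain x where x: "x \<in> C" "x \<noteq> \<one>" by auto
  have xG: "x \<in> carrier G" "x \<in> N" using x NG by (auto simp: C_def)
  have pow_C: "y [^] (i::nat) \<in> C" if y: "y \<in> C" for i y
  proof (induction i)
    case (Suc i)
    have yN: "y \<in> N" "y [^] i \<in> N" using y Suc by (auto simp: C_def)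
    show ?case
    proof (rule commuteI)
      show "y [^] Suc i \<in> N" using yN subgroup.m_closed[OF subN] by simp
      fix n assume n: "n \<in> N"
      have "n \<otimes> (y [^] i \<otimes> y) = (n \<otimes> y [^] i) \<otimes> y" using n yN NG by (simp add: m_assoc)
      also have "\<dots> = y [^] i \<otimes> (n \<otimes> y)" using commute[OF Suc n] n yN NG by (simp add: m_assoc)
      also have "\<dots> = (y [^] i \<otimes> y) \<otimes> n" using commute[OF y n] n yN NG by (simp add: m_assoc)
      finally show "n \<otimes> y [^] Suc i = y [^] Suc i \<otimes> n" by simp
    qed
  qed (use \<open>\<one> \<in> C\<close> in simp)
  have "x [^] (p ^ k) = \<one>"
  proof -
    interpret NN: group "G\<lparr>carrier := N\<rparr>" using subgroup_imp_group[OF subN] .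
    have "x [^]\<^bsub>G\<lparr>carrier := N\<rparr>\<^esub> (p ^ k) = \<one>"
      using NN.pow_order_eq_1[of x] xG N(3) by (simp add: Coset.order_def)
    then show ?thesis by (simp add: nat_pow_consistent[symmetric])
  qed
  \<comment> \<open>With \<open>j\<close> least, the power of \<open>x\<close> with exponent
    \<open>p ^ (j - 1)\<close> is nontrivial and its \<open>p\<close>-th power is
    \<open>\<one>\<close>.\<close>
  define j where "j = (LEAST j. x [^] (p ^ j) = \<one>)"
  have j: "x [^] (p ^ j) = \<one>" unfolding j_def by (rule LeastI) fact
  have "j \<noteq> 0" using j x xG by (cases j) auto
  then obtain i where i: "j = Suc i" by (cases j) auto
  define z where "z = x [^] (p ^ i)"
  have z: "z \<in> C" "z \<noteq> \<one>" "z [^] p = \<one>"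
  proof -
    show "z \<in> C" unfolding z_def using pow_C x by auto
    show "z \<noteq> \<one>" unfolding z_def using not_less_Least[of i "\<lambda>j. x [^] (p ^ j) = \<one>"] i j_def by auto
    show "z [^] p = \<one>" unfolding z_def using j i xG by (simp add: nat_pow_pow mult.commute)
  qed
  define Z where "Z = {z \<in> C. z [^] p = \<one>}"
  have CN: "y \<in> N" "y \<in> carrier G" if "y \<in> C" for y using that NG by (auto simp: C_def)
  have subZ: "subgroup Z G"
  proof (rule subgroupI)
    show "Z \<subseteq> carrier G" using CN by (auto simp: Z_def)
    show "Z \<noteq> {}" using z by (auto simp: Z_def)
    fix y assume "y \<in> Z"
    then have y: "y \<in> C" "y [^] p = \<one>" by (auto simp: Z_def)
    have "inv y \<in> C"
    proof (rule commuteI)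
      show "inv y \<in> N" using CN[OF y(1)] subgroup.m_inv_closed[OF subN] by auto
      fix n assume n: "n \<in> N"
      have "inv y \<otimes> (n \<otimes> y) \<otimes> inv y = inv y \<otimes> (y \<otimes> n) \<otimes> inv y" using commute[OF y(1) n] by simp
      then show "n \<otimes> inv y = inv y \<otimes> n" using n NG CN[OF y(1)] by (simp add: m_assoc)
    qed
    then show "inv y \<in> Z" using y CN by (simp add: Z_def nat_pow_inv)
    fix w assume "w \<in> Z"
    then have w: "w \<in> C" "w [^] p = \<one>" by (auto simp: Z_def)
    have "y \<otimes> w \<in> C"
    proof (rule commuteI)
      show "y \<otimes> w \<in> N" using CN y w subgroup.m_closed[OF subN] by auto
      fix n assume n: "n \<in> N"
      have "n \<otimes> (y \<otimes> w) = (n \<otimes> y) \<otimes> w" using n y w NG CN by (simp add: m_assoc)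
      also have "\<dots> = y \<otimes> (n \<otimes> w)" using commute[OF y(1) n] n y w NG CN by (simp add: m_assoc)
      also have "\<dots> = (y \<otimes> w) \<otimes> n" using commute[OF w(1) n] n y w NG CN by (simp add: m_assoc)
      finally show "n \<otimes> (y \<otimes> w) = (y \<otimes> w) \<otimes> n" .
    qed
    moreover have "(y \<otimes> w) [^] p = \<one>"
      using pow_mult_distrib[OF commute[OF w(1) CN(1)[OF y(1)]], of p] y w CN by simp
    ultimately show "y \<otimes> w \<in> Z" by (simp add: Z_def)
  qed
  have "Z \<lhd> G"
  proof (rule normal_invI[OF subZ])
    fix g y assume g: "g \<in> carrier G" and "y \<in> Z"
    then have y: "y \<in> C" "y [^] p = \<one>" by (auto simp: Z_def)
    have "g \<otimes> y \<otimes> inv g \<in> C"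
    proof (rule commuteI)
      show "g \<otimes> y \<otimes> inv g \<in> N" using normal.inv_op_closed2[OF N(1) g] CN[OF y(1)] by auto
      fix n assume n: "n \<in> N"
      have "inv g \<otimes> n \<otimes> g \<in> N" using normal.inv_op_closed1[OF N(1) g n] .
      then have eq: "(inv g \<otimes> n \<otimes> g) \<otimes> y = y \<otimes> (inv g \<otimes> n \<otimes> g)" using commute[OF y(1)] by auto
      have "n \<otimes> (g \<otimes> y \<otimes> inv g) = g \<otimes> ((inv g \<otimes> n \<otimes> g) \<otimes> y) \<otimes> inv g"
        using n NG CN[OF y(1)] g by (simp add: m_assoc)
      also have "\<dots> = (g \<otimes> y \<otimes> inv g) \<otimes> n"
        unfolding eq using n NG CN[OF y(1)] g by (simp add: m_assoc)
      finally show "n \<otimes> (g \<otimes> y \<otimes> inv g) = (g \<otimes> y \<otimes> inv g) \<otimes> n" .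
    qed
    moreover have "(g \<otimes> y \<otimes> inv g) [^] p = \<one>" using conj_nat_pow[OF g, of y p] y CN g by simp
    ultimately show "g \<otimes> y \<otimes> inv g \<in> Z" by (simp add: Z_def)
  qed
  moreover have "Z \<noteq> {\<one>}" using z by (auto simp: Z_def)
  ultimately show ?thesis using that commute CN by (auto simp: Z_def)
qed

end

section \<open>Cubic edge-transitive graphs\<close>

text \<open>By Bezout some multiple of \<open>i\<close> exceeds a multiple of \<open>j\<close> by 1,
  and both iterates fix \<open>x\<close>.\<close>

lemma funpow_fixed_coprime:
  fixes i j :: nat
  assumes "(f ^^ i) x = x" "(f ^^ j) x = x" "coprime i j" "i \<noteq> 0"
  shows "f x = x"
proof -
  obtain a b where ab: "i * a = j * b + 1"
    using bezout_nat[OF assms(4), of j] assms(3) by auto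
  have "(f ^^ (i * a)) x = x" using funpow_mod_eq[OF assms(1), of "i * a"] by simp
  moreover have "(f ^^ (j * b)) x = x" using funpow_mod_eq[OF assms(2), of "j * b"] by simp
  ultimately show ?thesis using ab by simp
qed

text \<open>Two of the first \<open>card S + 1\<close> iterates of \<open>x\<close> coincide, and
  injectivity cancels the earlier one. The bound on \<open>i\<close> is what later makes it coprime
  to a given order.\<close>

lemma funpow_return:
  assumes S: "finite S" and f: "inj_on f S" "f ` S \<subseteq> S" and x: "x \<in> S"
  obtains i where "0 < i" "i \<le> card S" "(f ^^ i) x = x"
proof -
  have mem: "(f ^^ i) y \<in> S" if "y \<in> S" for i y
    using that f(2) by (induction i) auto
  have inj: "inj_on (f ^^ i) S" for i
  proof (induction i)
    case (Suc i)
    show ?case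
    proof (rule inj_onI)
      fix y z assume yz: "y \<in> S" "z \<in> S" "(f ^^ Suc i) y = (f ^^ Suc i) z"
      then have "(f ^^ i) y = (f ^^ i) z" using f(1) mem by (auto dest: inj_onD)
      then show "y = z" using Suc yz by (auto dest: inj_onD)
    qed
  qed auto
  have "\<not> inj_on (\<lambda>i. (f ^^ i) x) {0..card S}"
  proof
    assume "inj_on (\<lambda>i. (f ^^ i) x) {0..card S}"
    then have "card {0..card S} \<le> card S" using mem[OF x] S by (intro card_inj_on_le) auto
    then show False by simp
  qed
  then obtain i j where "i \<le> card S" "j \<le> card S" "i \<noteq> j" "(f ^^ i) x = (f ^^ j) x"
    by (auto simp: inj_on_def)
  then obtain i j where ij: "i < j" "j \<le> card S" "(f ^^ i) x = (f ^^ j) x"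
    by (metis linorder_neqE_nat)
  have "(f ^^ i) ((f ^^ (j - i)) x) = (f ^^ i) x"
    using ij by (simp flip: funpow_add[THEN fun_cong, unfolded comp_def])
  then have "(f ^^ (j - i)) x = x" using inj x mem by (auto dest: inj_onD)
  then show ?thesis using that[of "j - i"] ij by auto
qed

lemma two_three_power_if_prime_divisors:
  assumes "n > 0" "\<And>p. Factorial_Ring.prime p \<Longrightarrow> p dvd n \<Longrightarrow> p = 2 \<or> p = (3::nat)"
  shows "\<exists>a b. n = 2 ^ a * 3 ^ b"
  using assms
proof (induction n rule: less_induct)
  case (less n)
  show ?case
  proof (cases "n = 1")
    case True
    then have "n = 2 ^ 0 * 3 ^ 0" by simp
    then show ?thesis by blast
  next
    case False
    then obtain p where p: "Factorial_Ring.prime p" "p dvd n" using prime_factor_nat by blast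
    then obtain m where m: "n = p * m" by auto
    have "\<exists>a b. m = 2 ^ a * 3 ^ b"
      using less.prems m prime_gt_1_nat[OF p(1)] by (intro less.IH) auto
    then obtain a b where ab: "m = 2 ^ a * 3 ^ b" by blast
    have "n = 2 ^ Suc a * 3 ^ b \<or> n = 2 ^ a * 3 ^ Suc b"
      using less.prems(2)[OF p] ab m by auto
    then show ?thesis by blast
  qed
qed

section \<open>The action of the group on vertices and neighbourhoods\<close>

definition perm_group :: "'a set \<Rightarrow> ('a \<Rightarrow> 'a) set \<Rightarrow> ('a \<Rightarrow> 'a) monoid" where
  "perm_group V G = BijGroup V\<lparr>carrier := G\<rparr>"

locale edge_transitive_cubic_graph =
  fixes V :: "'a set" and E :: "'a \<Rightarrow> 'a \<Rightarrow> bool" and G :: "('a \<Rightarrow> 'a) set"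
  assumes graph: "simple_graph V E" and conn: "connected_graph V E" and cub: "cubic V E"
    and sub: "subgroup G (BijGroup V)" and aut: "G \<subseteq> graph_aut V E"
    and edge_trans: "edge_transitive E G"
begin

abbreviation "H \<equiv> perm_group V G"

definition nb :: "'a \<Rightarrow> 'a set" where "nb v = {w. E v w}"

lemma carrier_H [simp]: "carrier H = G" by (simp add: perm_group_def)

lemma group_H: "group H"
  unfolding perm_group_def using group.subgroup_imp_group[OF group_BijGroup sub] .

sublocale grp: group H by (rule group_H)

lemma finV: "finite V" using graph by (simp add: simple_graph_def)

lemma E_V: "E x y \<Longrightarrow> x \<in> V" "E x y \<Longrightarrow> y \<in> V" and E_sym: "E x y \<Longrightarrow> E y x"
  using graph by (auto simp: simple_graph_def)

lemma G_Bij: "g \<in> G \<Longrightarrow> g \<in> Bij V" using subgroup.mem_carrier[OF sub] by (simp add: BijGroup_def)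

lemma G_closed: "g \<in> G \<Longrightarrow> v \<in> V \<Longrightarrow> g v \<in> V"
  using G_Bij by (auto simp: Bij_def bij_betw_def)

lemma G_inj: "g \<in> G \<Longrightarrow> u \<in> V \<Longrightarrow> v \<in> V \<Longrightarrow> g u = g v \<longleftrightarrow> u = v"
  using G_Bij by (auto simp: Bij_def bij_betw_def dest: inj_onD)

lemma G_ext: "g \<in> G \<Longrightarrow> h \<in> G \<Longrightarrow> (\<And>v. v \<in> V \<Longrightarrow> g v = h v) \<Longrightarrow> g = h"
  using G_Bij by (auto simp: Bij_def intro: extensionalityI)

lemma G_E: "g \<in> G \<Longrightarrow> u \<in> V \<Longrightarrow> v \<in> V \<Longrightarrow> E (g u) (g v) \<longleftrightarrow> E u v"
  using aut by (auto simp: graph_aut_def)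

lemma finG: "finite G"
proof -
  have "G \<subseteq> V \<rightarrow>\<^sub>E V"
    using G_Bij G_closed by (auto simp: Bij_def PiE_def)
  then show ?thesis using finite_PiE[OF finV] finV by (meson finite_subset)
qed

lemma one_apply [simp]: "v \<in> V \<Longrightarrow> \<one>\<^bsub>H\<^esub> v = v"
  by (simp add: perm_group_def BijGroup_def)

lemma mult_apply [simp]: "g \<in> G \<Longrightarrow> h \<in> G \<Longrightarrow> v \<in> V \<Longrightarrow> (g \<otimes>\<^bsub>H\<^esub> h) v = g (h v)"
  using G_Bij by (simp add: perm_group_def BijGroup_def compose_eq)

lemma mult_G [simp]: "g \<in> G \<Longrightarrow> h \<in> G \<Longrightarrow> g \<otimes>\<^bsub>H\<^esub> h \<in> G"
  using grp.m_closed by simp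

lemma inv_G [simp]: "g \<in> G \<Longrightarrow> inv\<^bsub>H\<^esub> g \<in> G"
  using grp.inv_closed by simp

lemma one_G [simp]: "\<one>\<^bsub>H\<^esub> \<in> G"
  using grp.one_closed by simp

lemma inv_apply [simp]:
  assumes "g \<in> G" "v \<in> V"
  shows "(inv\<^bsub>H\<^esub> g) (g v) = v" "g ((inv\<^bsub>H\<^esub> g) v) = v"
  using mult_apply[of "inv\<^bsub>H\<^esub> g" g v] mult_apply[of g "inv\<^bsub>H\<^esub> g" v] assms grp.l_inv grp.r_inv by auto

lemma inv_fix: "g \<in> G \<Longrightarrow> v \<in> V \<Longrightarrow> g v = v \<Longrightarrow> (inv\<^bsub>H\<^esub> g) v = v"
  using inv_apply(1)[of g v] by simp

lemma pow_apply:
  assumes "g \<in> G"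
  shows "v \<in> V \<Longrightarrow> (g [^]\<^bsub>H\<^esub> (n::nat)) v = (g ^^ n) v"
proof (induction n arbitrary: v)
  case (Suc n)
  have "g [^]\<^bsub>H\<^esub> n \<in> G" using assms grp.nat_pow_closed by simp
  then show ?case using Suc assms G_closed by (simp add: funpow_swap1)
qed simp

lemma nb_V: "nb v \<subseteq> V" using E_V by (auto simp: nb_def)

lemma nb_sym: "w \<in> nb v \<longleftrightarrow> v \<in> nb w" using E_sym by (auto simp: nb_def)

lemma finite_nb: "finite (nb v)" using nb_V finV finite_subset by blast

lemma card_nb: "v \<in> V \<Longrightarrow> card (nb v) = 3" using cub by (simp add: cubic_def nb_def)

lemma G_nb: "g \<in> G \<Longrightarrow> v \<in> V \<Longrightarrow> w \<in> nb v \<Longrightarrow> g w \<in> nb (g v)"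
  using G_E E_V by (auto simp: nb_def)

lemma G_nb_image:
  assumes g: "g \<in> G" and v: "v \<in> V"
  shows "nb (g v) = g ` nb v"
proof
  show "g ` nb v \<subseteq> nb (g v)" using G_nb assms by auto
  show "nb (g v) \<subseteq> g ` nb v"
  proof
    fix w assume w: "w \<in> nb (g v)"
    have "(inv\<^bsub>H\<^esub> g) w \<in> nb ((inv\<^bsub>H\<^esub> g) (g v))" using G_nb[of "inv\<^bsub>H\<^esub> g" "g v" w] assms w G_closed by simp
    moreover have "w = g ((inv\<^bsub>H\<^esub> g) w)" using assms w nb_V by (metis inv_apply(2) subsetD)
    ultimately show "w \<in> g ` nb v" using assms by simp
  qed
qed

lemma connected_induct:
  assumes v: "v \<in> V" "P v" and step: "\<And>u w. u \<in> V \<Longrightarrow> P u \<Longrightarrow> w \<in> nb u \<Longrightarrow> P w" and u: "u \<in> V"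
  shows "P u"
proof -
  have "E\<^sup>*\<^sup>* v u" using conn v u by (simp add: connected_graph_def)
  then have "u \<in> V \<and> P u"
    by (induction rule: rtranclp_induct) (use v step E_V in \<open>auto simp: nb_def\<close>)
  then show ?thesis ..
qed

section \<open>Criteria for semiregularity\<close>

text \<open>All integer powers of \<open>x\<close> stay in \<open>P\<close>, so it suffices that no
  nontrivial element of \<open>P\<close> fixes a vertex.\<close>

lemma semiregular_of_subgroup:
  assumes P: "subgroup P H" and x: "x \<in> P" "x \<noteq> \<one>\<^bsub>H\<^esub>"
    and fp: "\<And>y v. y \<in> P \<Longrightarrow> v \<in> V \<Longrightarrow> y v = v \<Longrightarrow> y = \<one>\<^bsub>H\<^esub>"
  shows "semiregular_element V x"
proof -
  have one: "\<one>\<^bsub>H\<^esub> = \<one>\<^bsub>BijGroup V\<^esub>" by (simp add: perm_group_def)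
  have "subgroup P (BijGroup V)"
    using group.incl_subgroup[OF group_BijGroup sub] P by (simp add: perm_group_def)
  then have "x [^]\<^bsub>BijGroup V\<^esub> (k::int) \<in> P" for k
    using group.subgroup_int_pow_closed[OF group_BijGroup _ x(1)] by blast
  then show ?thesis unfolding semiregular_element_def using x fp one by auto
qed

text \<open>The powers of \<open>h\<close> are the identity, \<open>h\<close> and its square. A
  vertex fixed by the square is fixed by \<open>h\<close>, since the cube fixes it as well.\<close>

lemma semiregular_of_order_three:
  assumes h: "h \<in> G" "\<And>v. v \<in> V \<Longrightarrow> h (h (h v)) = v" "\<And>v. v \<in> V \<Longrightarrow> h v \<noteq> v"
  shows "semiregular_element V h"
proof (rule semiregular_of_subgroup)
  let ?P = "{\<one>\<^bsub>H\<^esub>, h, h \<otimes>\<^bsub>H\<^esub> h}"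
  have cube: "h \<otimes>\<^bsub>H\<^esub> (h \<otimes>\<^bsub>H\<^esub> h) = \<one>\<^bsub>H\<^esub>"
    by (rule G_ext) (use h in auto)
  then have cube': "h \<otimes>\<^bsub>H\<^esub> h \<otimes>\<^bsub>H\<^esub> h = \<one>\<^bsub>H\<^esub>" using grp.m_assoc h(1) by simp
  have i: "inv\<^bsub>H\<^esub> h = h \<otimes>\<^bsub>H\<^esub> h" using grp.inv_equality[OF cube'] h(1) by simp
  then have i': "inv\<^bsub>H\<^esub> (h \<otimes>\<^bsub>H\<^esub> h) = h" using grp.inv_inv[of h] h(1) by simp
  have q: "h \<otimes>\<^bsub>H\<^esub> h \<otimes>\<^bsub>H\<^esub> (h \<otimes>\<^bsub>H\<^esub> h) = h"
    by (rule G_ext) (use h G_closed in auto)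
  show "subgroup ?P H"
    by (rule grp.subgroupI) (use h(1) cube cube' i i' q in \<open>auto simp: grp.l_one grp.r_one\<close>)
  show "h \<in> ?P" by simp
  obtain v where v: "v \<in> V" using conn by (auto simp: connected_graph_def)
  show "h \<noteq> \<one>\<^bsub>H\<^esub>" using h(3)[OF v] v by auto
  fix y v assume y: "y \<in> ?P" and v: "v \<in> V" "y v = v"
  have "h (h v) \<noteq> v"
  proof
    assume "h (h v) = v"
    then have "h v = v" using h(2)[OF v(1)] by simp
    then show False using h(3)[OF v(1)] by simp
  qed
  then show "y = \<one>\<^bsub>H\<^esub>" using y v h by auto
qed

section \<open>Transitivity of vertex stabilisers on neighbours\<close>

text \<open>Edge-transitivity conjugates a reversal of one edge to a reversal \<open>r\<close> of
  the edge from \<open>v\<close> to \<open>x\<close>. If the element carrying this edge to the one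
  from \<open>v\<close> to \<open>y\<close> does not fix \<open>v\<close>, performing
  \<open>r\<close> first corrects it.\<close>

lemma arc_reversal_imp_locally_transitive:
  assumes k: "k \<in> G" "E a b" "k a = b" "k b = a" and vx: "E v x" and vy: "E v y"
  shows "\<exists>g\<in>G. g v = v \<and> g x = y"
proof -
  note V = E_V[OF k(2)] E_V[OF vx] E_V[OF vy]
  obtain g where g: "g \<in> G" "{g v, g x} = {v, y}"
    using edge_trans vx vy unfolding edge_transitive_def by blast
  show ?thesis
  proof (cases "g v = v")
    case True
    then have "g x = y" using g(2) by (metis doubleton_eq_iff)
    then show ?thesis using g True by blast
  next
    case False
    then have gv: "g v = y" "g x = v" using g(2) by (metis doubleton_eq_iff)+
    obtain h where h: "h \<in> G" "{h a, h b} = {v, x}"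
      using edge_trans k(2) vx unfolding edge_transitive_def by blast
    define r where "r = h \<otimes>\<^bsub>H\<^esub> k \<otimes>\<^bsub>H\<^esub> inv\<^bsub>H\<^esub> h"
    have r: "r \<in> G" "r (h a) = h b" "r (h b) = h a"
      using h k V G_closed by (auto simp: r_def)
    then have "r v = x" "r x = v" using h(2) by (metis doubleton_eq_iff)+
    then have "(g \<otimes>\<^bsub>H\<^esub> r) v = v" "(g \<otimes>\<^bsub>H\<^esub> r) x = y" using g r V gv by auto
    then show ?thesis using g r by (intro bexI[of _ "g \<otimes>\<^bsub>H\<^esub> r"]) auto
  qed
qed

text \<open>If some vertex stabiliser is intransitive on neighbours, then no arc is reversed and each of the
  two orbits on arcs is an orientation of the graph. Vertices are then all equivalent, so in- and
  out-degrees are constant, hence equal, contradicting the odd valency.\<close>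

lemma locally_transitive:
  assumes vx: "E v x" and vy: "E v y"
  shows "\<exists>g\<in>G. g v = v \<and> g x = y"
proof (rule ccontr)
  assume no: "\<not> ?thesis"
  note V = E_V[OF vx] E_V[OF vy]
  obtain g where g: "g \<in> G" "{g v, g x} = {v, y}"
    using edge_trans vx vy unfolding edge_transitive_def by blast
  have gv: "g v = y" "g x = v" using g no by (metis doubleton_eq_iff)+
  \<comment> \<open>\<open>R\<close> is the orbit of the arc from \<open>v\<close> to
    \<open>x\<close>; the arcs outside it are the reversed ones.\<close>
  define R where "R a b \<longleftrightarrow> (\<exists>h\<in>G. h v = a \<and> h x = b)" for a b
  have R_E: "E a b" if "R a b" for a b using that vx V G_E by (auto simp: R_def)
  have R_asym: "\<not> R b a" if ab: "R a b" for a b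
  proof
    assume "R b a"
    then obtain h k where h: "h \<in> G" "h v = b" "h x = a" and k: "k \<in> G" "k v = a" "k x = b"
      using ab by (auto simp: R_def)
    define r where "r = h \<otimes>\<^bsub>H\<^esub> inv\<^bsub>H\<^esub> k"
    have "r (k v) = h v" "r (k x) = h x" "r \<in> G" using h(1) k(1) V G_closed by (auto simp: r_def)
    then have "r a = b" "r b = a" "r \<in> G" using h k by auto
    from arc_reversal_imp_locally_transitive[OF this(3) R_E[OF ab] this(1,2) vx vy] show False
      using no by simp
  qed
  have R_total: "R a b \<or> R b a" if ab: "E a b" for a b
  proof -
    obtain h where "h \<in> G" "{h v, h x} = {a, b}"
      using edge_trans vx ab unfolding edge_transitive_def by blast
    then show ?thesis unfolding R_def by (metis doubleton_eq_iff)
  qed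
  have R_G: "R (h a) (h b) \<longleftrightarrow> R a b" if h: "h \<in> G" "a \<in> V" "b \<in> V" for h a b
  proof
    assume "R a b"
    then obtain k where "k \<in> G" "k v = a" "k x = b" by (auto simp: R_def)
    then show "R (h a) (h b)" unfolding R_def using h V by (intro bexI[of _ "h \<otimes>\<^bsub>H\<^esub> k"]) auto
  next
    assume "R (h a) (h b)"
    then obtain k where "k \<in> G" "k v = h a" "k x = h b" by (auto simp: R_def)
    then show "R a b" unfolding R_def using h V by (intro bexI[of _ "inv\<^bsub>H\<^esub> h \<otimes>\<^bsub>H\<^esub> k"]) auto
  qed
  \<comment> \<open>Each vertex is the tail or the head of an arc in \<open>R\<close>. A head is
    reached from \<open>v\<close> by first applying the inverse of \<open>g\<close>, which sends
    \<open>v\<close> to \<open>x\<close>.\<close>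
  have vtrans: "\<exists>h\<in>G. h v = u" if u: "u \<in> V" for u
  proof -
    have "nb u \<noteq> {}" using card_nb[OF u] by auto
    then obtain w where "E u w" by (auto simp: nb_def)
    then have "R u w \<or> R w u" by (rule R_total)
    then show ?thesis
    proof
      assume "R w u"
      then obtain h where h: "h \<in> G" "h x = u" by (auto simp: R_def)
      have "(h \<otimes>\<^bsub>H\<^esub> inv\<^bsub>H\<^esub> g) (g x) = u" using h g V G_closed by auto
      then show ?thesis using gv h g by (intro bexI[of _ "h \<otimes>\<^bsub>H\<^esub> inv\<^bsub>H\<^esub> g"]) auto
    qed (auto simp: R_def)
  qed
  have V_image: "{b \<in> V. Q b} = h ` {b \<in> V. Q (h b)}" if h: "h \<in> G" for h Q
  proof
    show "{b \<in> V. Q b} \<subseteq> h ` {b \<in> V. Q (h b)}"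
    proof
      fix b assume b: "b \<in> {b \<in> V. Q b}"
      have "b = h ((inv\<^bsub>H\<^esub> h) b)" using b h by simp
      moreover have "(inv\<^bsub>H\<^esub> h) b \<in> V" using b h G_closed by simp
      ultimately show "b \<in> h ` {b \<in> V. Q (h b)}" using b by (metis (mono_tags, lifting) image_eqI mem_Collect_eq)
    qed
  qed (use h G_closed in auto)
  have card_img: "card (h ` {b \<in> V. Q b}) = card {b \<in> V. Q b}" if h: "h \<in> G" for h Q
    using G_inj[OF h] by (intro card_image) (auto intro!: inj_onI)
  define d e where "d = card {b \<in> V. R v b}" and "e = card {b \<in> V. R b v}"
  have out: "card {b \<in> V. R u b} = d" if u: "u \<in> V" for u
  proof -
    obtain h where h: "h \<in> G" "h v = u" using vtrans[OF u] by auto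
    have "card {b \<in> V. R u b} = card {b \<in> V. R (h v) (h b)}"
      using V_image[OF h(1), of "R u"] card_img[OF h(1)] h by simp
    also have "{b \<in> V. R (h v) (h b)} = {b \<in> V. R v b}" using R_G h V by auto
    finally show ?thesis by (simp add: d_def)
  qed
  have in': "card {b \<in> V. R b u} = e" if u: "u \<in> V" for u
  proof -
    obtain h where h: "h \<in> G" "h v = u" using vtrans[OF u] by auto
    have "card {b \<in> V. R b u} = card {b \<in> V. R (h b) (h v)}"
      using V_image[OF h(1), of "\<lambda>b. R b u"] card_img[OF h(1)] h by simp
    also have "{b \<in> V. R (h b) (h v)} = {b \<in> V. R b v}" using R_G h V by auto
    finally show ?thesis by (simp add: e_def)
  qed
  have "(\<Sum>a\<in>V. card {b \<in> V. R a b}) = e * card V"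
    using in' by (intro sum_multicount finV) auto
  moreover have "(\<Sum>a\<in>V. card {b \<in> V. R a b}) = d * card V" using out by simp
  ultimately have "d * card V = e * card V" by argo
  moreover have "card V > 0" using finV V by (auto simp: card_gt_0_iff)
  ultimately have "d = e" by simp
  moreover have "d + e = 3"
  proof -
    have "nb v = {b \<in> V. R v b} \<union> {b \<in> V. R b v}"
      using R_total R_E E_sym E_V by (auto simp: nb_def)
    moreover have "{b \<in> V. R v b} \<inter> {b \<in> V. R b v} = {}" using R_asym by auto
    ultimately have "card (nb v) = d + e"
      using finV by (simp add: card_Un_disjoint d_def e_def)
    then show ?thesis using card_nb V by simp
  qed
  ultimately show False by presburger
qed

section \<open>Propagation of fixed vertices, and the two easy cases\<close>

lemma identity_of_fixed_propagation:
  assumes x: "x \<in> G" and v: "v \<in> V" "x v = v"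
    and step: "\<And>u w. u \<in> V \<Longrightarrow> x u = u \<Longrightarrow> w \<in> nb u \<Longrightarrow> x w = w"
  shows "x = \<one>\<^bsub>H\<^esub>"
proof (rule G_ext)
  fix u assume "u \<in> V"
  have "x u = u"
    by (rule connected_induct[where v = v and P = "\<lambda>u. x u = u"]) (use v step \<open>u \<in> V\<close> in blast)+
  then show "x u = \<one>\<^bsub>H\<^esub> u" using \<open>u \<in> V\<close> by simp
qed (use x in auto)

text \<open>Under \<open>x\<close> the vertex \<open>w\<close> returns after at most
  \<open>card S\<close> steps and also after \<open>n\<close> steps. These numbers are coprime, so
  it returns after one.\<close>

lemma fixes_neighbour:
  assumes x: "x \<in> G" "u \<in> V" "x u = u" and n: "x [^]\<^bsub>H\<^esub> (n::nat) = \<one>\<^bsub>H\<^esub>"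
    and S: "S \<subseteq> nb u" "x ` S \<subseteq> S" "w \<in> S" and cop: "\<And>i. 0 < i \<Longrightarrow> i \<le> card S \<Longrightarrow> coprime i n"
  shows "x w = w"
proof -
  have wV: "w \<in> V" using S nb_V by auto
  have fin: "finite S" using S(1) finite_nb finite_subset by blast
  have inj: "inj_on x S" using G_inj[OF x(1)] S(1) nb_V by (meson inj_onI subsetD)
  obtain i where i: "0 < i" "i \<le> card S" "(x ^^ i) w = w"
    using funpow_return[OF fin inj S(2,3)] by blast
  have "(x ^^ n) w = w" using pow_apply[OF x(1) wV, of n] n wV by simp
  then show ?thesis using funpow_fixed_coprime[OF i(3)] cop[OF i(1,2)] i(1) by simp
qed

lemma semiregular_of_large_prime:
  assumes p: "Factorial_Ring.prime p" "p dvd card G" "p > 3"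
  shows "\<exists>g\<in>G. semiregular_element V g"
proof -
  obtain m where m: "card G = p ^ 1 * m" using p(2) by auto
  have "Coset.order H = p ^ 1 * m" using m by (simp add: Coset.order_def)
  \<comment> \<open>Sylow's theorem with exponent 1, that is, Cauchy's theorem: \<open>P\<close> has
    order \<open>p\<close>.\<close>
  then obtain P where P: "subgroup P H" "card P = p ^ 1"
    using sylow_thm[OF p(1) group_H, of 1 m] finG by auto
  have "P \<noteq> {\<one>\<^bsub>H\<^esub>}" using P(2) p(3) by auto
  then obtain x where x: "x \<in> P" "x \<noteq> \<one>\<^bsub>H\<^esub>" using subgroup.one_closed[OF P(1)] by auto
  have PG: "P \<subseteq> G" using subgroup.subset[OF P(1)] by simp
  have "semiregular_element V x"
  proof (rule semiregular_of_subgroup[OF P(1) x])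
    fix y v assume y: "y \<in> P" and v: "v \<in> V" "y v = v"
    have yG: "y \<in> G" using y PG by auto
    have pow: "y [^]\<^bsub>H\<^esub> p = \<one>\<^bsub>H\<^esub>"
    proof -
      interpret PP: group "H\<lparr>carrier := P\<rparr>" using grp.subgroup_imp_group[OF P(1)] .
      have "y [^]\<^bsub>H\<lparr>carrier := P\<rparr>\<^esub> p = \<one>\<^bsub>H\<^esub>"
        using PP.pow_order_eq_1[of y] y P(2) by (simp add: Coset.order_def)
      then show ?thesis by (simp add: grp.nat_pow_consistent[symmetric])
    qed
    show "y = \<one>\<^bsub>H\<^esub>"
    proof (rule identity_of_fixed_propagation[OF yG v])
      fix u w assume u: "u \<in> V" "y u = u" "w \<in> nb u"
      show "y w = w"
      proof (rule fixes_neighbour[OF yG u(1,2) pow, of "nb u"])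
        show "y ` nb u \<subseteq> nb u" using G_nb_image[OF yG u(1)] u(2) by simp
        fix i :: nat assume "0 < i" "i \<le> card (nb u)"
        then have "\<not> p dvd i" using card_nb[OF u(1)] p(3) by (auto dest: dvd_imp_le)
        then show "coprime i p" using prime_imp_coprime[OF p(1)] by (simp add: coprime_commute)
      qed (use u in auto)
    qed
  qed
  then show ?thesis using x PG by auto
qed

lemma semiregular_of_normal_two_subgroup:
  assumes N: "N \<lhd> H" "N \<noteq> {\<one>\<^bsub>H\<^esub>}" "card N = 2 ^ k"
  shows "\<exists>g\<in>G. semiregular_element V g"
proof -
  have subN: "subgroup N H" using N(1) by (rule normal_imp_subgroup)
  have NG: "N \<subseteq> G" using subgroup.subset[OF subN] by simp
  obtain x where x: "x \<in> N" "x \<noteq> \<one>\<^bsub>H\<^esub>" using N(2) subgroup.one_closed[OF subN] by auto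
  have fix_nb: "n w = w" if u: "u \<in> V" and n: "n \<in> N" "n u = u" and w: "w \<in> nb u" for u n w
  proof -
    define S where "S = {n \<in> N. n u = u}"
    have subS: "subgroup S H"
    proof (rule grp.subgroupI)
      show "S \<subseteq> carrier H" using NG by (auto simp: S_def)
      show "S \<noteq> {}" using n by (auto simp: S_def)
      fix a assume a: "a \<in> S"
      then have aG: "a \<in> G" using NG by (auto simp: S_def)
      show "inv\<^bsub>H\<^esub> a \<in> S"
        using a aG u inv_fix subgroup.m_inv_closed[OF subN] by (auto simp: S_def)
      fix b assume b: "b \<in> S"
      then have "b \<in> G" using NG by (auto simp: S_def)
      then show "a \<otimes>\<^bsub>H\<^esub> b \<in> S"
        using a b aG u subgroup.m_closed[OF subN] by (auto simp: S_def)
    qed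
    have SN: "S \<subseteq> N" by (auto simp: S_def)
    have "subgroup S (H\<lparr>carrier := N\<rparr>)" using grp.subgroup_incl[OF subS subN SN] .
    from group.lagrange[OF grp.subgroup_imp_group[OF subN] this]
    have "card (rcosets\<^bsub>H\<lparr>carrier := N\<rparr>\<^esub> S) * card S = card N" by (simp add: Coset.order_def)
    then have "card S dvd card N" by (metis dvd_triv_right)
    then obtain j where j: "card S = 2 ^ j"
      using N(3) divides_primepow_nat[of 2 "card S" k] by auto
    have SG: "s \<in> G" if "s \<in> S" for s using that NG SN by auto
    \<comment> \<open>The 2-group \<open>S\<close>, the stabiliser of \<open>u\<close> in
      \<open>N\<close>, acts on three neighbours; as 3 is odd, it fixes one of them.\<close>
    have "2 dvd card (nb u) \<longleftrightarrow>
        2 dvd card {x \<in> nb u. \<forall>g\<in>carrier (H\<lparr>carrier := S\<rparr>). g x = x}"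
    proof (rule p_group_card_fixed_points[where k = j])
      show "group (H\<lparr>carrier := S\<rparr>)" using grp.subgroup_imp_group[OF subS] .
      show "card (carrier (H\<lparr>carrier := S\<rparr>)) = 2 ^ j" using j by simp
      show "g x \<in> nb u" if "g \<in> carrier (H\<lparr>carrier := S\<rparr>)" "x \<in> nb u" for g x
        using that SG G_nb[of g u x] u by (auto simp: S_def)
      show "\<one>\<^bsub>H\<lparr>carrier := S\<rparr>\<^esub> x = x" if "x \<in> nb u" for x
        using one_apply[OF subsetD[OF nb_V that]] by simp
      show "(g \<otimes>\<^bsub>H\<lparr>carrier := S\<rparr>\<^esub> h) x = g (h x)"
        if "g \<in> carrier (H\<lparr>carrier := S\<rparr>)" "h \<in> carrier (H\<lparr>carrier := S\<rparr>)" "x \<in> nb u" for g h x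
        using that SG mult_apply[of g h x] subsetD[OF nb_V that(3)] by simp
    qed (use finite_nb in auto)
    moreover have "\<not> 2 dvd card (nb u)" using card_nb[OF u] by simp
    ultimately have "card {x \<in> nb u. \<forall>g\<in>S. g x = x} \<noteq> 0" by (intro notI) simp
    then obtain y where y: "y \<in> nb u" "\<And>g. g \<in> S \<Longrightarrow> g y = y" by (auto simp: card_eq_0_iff)
    \<comment> \<open>An element fixing \<open>u\<close> and moving \<open>y\<close> to
      \<open>w\<close> conjugates \<open>n\<close> back into \<open>S\<close>, which fixes
      \<open>y\<close>; hence \<open>n\<close> fixes \<open>w\<close>.\<close>
    obtain h where h: "h \<in> G" "h u = u" "h y = w"
      using locally_transitive[of u y w] y(1) w by (auto simp: nb_def)
    have nG: "n \<in> G" using n NG by auto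
    have yV: "y \<in> V" and wV: "w \<in> V" using subsetD[OF nb_V y(1)] subsetD[OF nb_V w] by auto
    have "inv\<^bsub>H\<^esub> h \<otimes>\<^bsub>H\<^esub> n \<otimes>\<^bsub>H\<^esub> h \<in> N" using normal.inv_op_closed1[OF N(1), of h n] h n by simp
    moreover have "(inv\<^bsub>H\<^esub> h \<otimes>\<^bsub>H\<^esub> n \<otimes>\<^bsub>H\<^esub> h) u = u" using h n nG u inv_fix by simp
    ultimately have "(inv\<^bsub>H\<^esub> h \<otimes>\<^bsub>H\<^esub> n \<otimes>\<^bsub>H\<^esub> h) y = y" using y(2) by (auto simp: S_def)
    then have "(inv\<^bsub>H\<^esub> h) (n w) = y" using h(1,3) nG yV wV by simp
    then have "h ((inv\<^bsub>H\<^esub> h) (n w)) = w" using h(3) by simp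
    then show "n w = w" using inv_apply(2)[OF h(1) G_closed[OF nG wV]] by simp
  qed
  have "semiregular_element V x"
  proof (rule semiregular_of_subgroup[OF subN x])
    fix y v assume "y \<in> N" "v \<in> V" "y v = v"
    then show "y = \<one>\<^bsub>H\<^esub>" using NG fix_nb by (intro identity_of_fixed_propagation[of y v]) blast+
  qed
  then show ?thesis using x NG by auto
qed

section \<open>Normal 3-subgroups\<close>

text \<open>Once a vertex and one neighbour are fixed, two neighbours remain, and a permutation
  whose cube is trivial cannot move them. The fixed arc thus spreads along paths.\<close>

lemma cube_fixing_arc:
  assumes x: "x \<in> G" "x [^]\<^bsub>H\<^esub> (3::nat) = \<one>\<^bsub>H\<^esub>" and v: "v \<in> V" "x v = v" and w: "w \<in> nb v" "x w = w"
  shows "x = \<one>\<^bsub>H\<^esub>"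
proof (rule G_ext)
  \<comment> \<open>The induction predicate carries a fixed neighbour along; for a new vertex this
    is the one it was reached from.\<close>
  let ?P = "\<lambda>u. x u = u \<and> (\<exists>w\<in>nb u. x w = w)"
  fix u assume u: "u \<in> V"
  have "?P u"
  proof (rule connected_induct[where v = v and P = ?P])
    fix u w assume u: "u \<in> V" "?P u" and w: "w \<in> nb u"
    then obtain y where y: "y \<in> nb u" "x y = y" by auto
    have "x w = w"
    proof (cases "w = y")
      case False
      have "card (nb u - {y}) = 2" using y card_nb[OF u(1)] finite_nb by simp
      moreover have "coprime i (3::nat)" if "0 < i" "i \<le> 2" for i
      proof -
        have "\<not> 3 dvd i" using that by (auto dest: dvd_imp_le)
        then show ?thesis using prime_imp_coprime[of "3::nat" i] by (simp add: coprime_commute)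
      qed
      moreover have "x ` (nb u - {y}) \<subseteq> nb u - {y}"
      proof
        fix z assume "z \<in> x ` (nb u - {y})"
        then obtain a where a: "a \<in> nb u" "a \<noteq> y" "z = x a" by auto
        have "x a \<noteq> x y" using G_inj[OF x(1)] a y nb_V by (metis subsetD)
        then show "z \<in> nb u - {y}" using a y u G_nb[OF x(1) u(1) a(1)] by auto
      qed
      ultimately show ?thesis
        using fixes_neighbour[OF x(1) u(1) _ x(2), of "nb u - {y}" w] u w False by auto
    qed (use y in simp)
    then show "?P w" using u w nb_sym by auto
  qed (use v w u in auto)
  then show "x u = \<one>\<^bsub>H\<^esub> u" using u by simp
qed (use x in auto)

text \<open>Elements fixing \<open>w\<close> move \<open>x1\<close> to \<open>x2\<close> and to
  \<open>x3\<close>. If neither acts as a 3-cycle, both act as transpositions, distinct ones, and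
  their product is a 3-cycle. Nothing is claimed about its cube away from
  \<open>nb w\<close>.\<close>

lemma three_cycle_on_neighbours:
  assumes w: "w \<in> V"
  obtains c where "c \<in> G" "c w = w" "\<And>x. x \<in> nb w \<Longrightarrow> c x \<noteq> x" "\<And>x. x \<in> nb w \<Longrightarrow> c (c (c x)) = x"
proof -
  obtain x1 x2 x3 where nb: "nb w = {x1, x2, x3}" and ne: "x1 \<noteq> x2" "x2 \<noteq> x3" "x1 \<noteq> x3"
    using card_nb[OF w] by (auto simp: card_3_iff)
  have xV: "x1 \<in> V" "x2 \<in> V" "x3 \<in> V" using nb nb_V[of w] by auto
  obtain g where g: "g \<in> G" "g w = w" "g x1 = x2"
    using locally_transitive[of w x1 x2] nb by (auto simp: nb_def)
  obtain h where h: "h \<in> G" "h w = w" "h x1 = x3"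
    using locally_transitive[of w x1 x3] nb by (auto simp: nb_def)
  have gx: "g x2 \<in> {x1, x2, x3}" "g x3 \<in> {x1, x2, x3}" "g x1 \<noteq> g x2" "g x1 \<noteq> g x3" "g x2 \<noteq> g x3"
    using G_nb[OF g(1) w] g nb G_inj[OF g(1)] xV ne by auto
  have hx: "h x2 \<in> {x1, x2, x3}" "h x3 \<in> {x1, x2, x3}" "h x1 \<noteq> h x2" "h x1 \<noteq> h x3" "h x2 \<noteq> h x3"
    using G_nb[OF h(1) w] h nb G_inj[OF h(1)] xV ne by auto
  consider "g x2 = x3" "g x3 = x1" | "h x3 = x2" "h x2 = x1"
    | "g x2 = x1" "g x3 = x3" "h x3 = x1" "h x2 = x2"
    using gx hx g(3) h(3) by auto
  then show ?thesis
  proof cases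
    case 1
    show ?thesis
      by (rule that[OF g(1,2)]) (use 1 g(3) nb ne in auto)
  next
    case 2
    show ?thesis
      by (rule that[OF h(1,2)]) (use 2 h(3) nb ne in auto)
  next
    case 3
    have gh: "(g \<otimes>\<^bsub>H\<^esub> h) u = g (h u)" if "u \<in> V" for u using g(1) h(1) that by simp
    show ?thesis
      by (rule that[of "g \<otimes>\<^bsub>H\<^esub> h"]) (use 3 g h nb ne xV w gh in auto)
  qed
qed

text \<open>With no semiregular element, every member of \<open>Z\<close> fixes a vertex. Since
  \<open>Z\<close> is abelian, vertices in one \<open>Z\<close>-orbit have equal stabilisers in
  \<open>Z\<close>; the stabilisers at a vertex \<open>w\<close> and at its neighbours then
  determine the graph. Two configurations survive, both on 3 + 3 vertices, and each contains an
  explicit element without fixed points.\<close>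

lemma semiregular_of_normal_elementary_abelian:
  assumes Z: "Z \<lhd> H" "Z \<noteq> {\<one>\<^bsub>H\<^esub>}"
    and comm: "\<And>x y. x \<in> Z \<Longrightarrow> y \<in> Z \<Longrightarrow> x \<otimes>\<^bsub>H\<^esub> y = y \<otimes>\<^bsub>H\<^esub> x"
    and exp3: "\<And>x. x \<in> Z \<Longrightarrow> x [^]\<^bsub>H\<^esub> (3::nat) = \<one>\<^bsub>H\<^esub>"
  shows "\<exists>g\<in>G. semiregular_element V g"
proof (rule ccontr)
  assume no: "\<not> ?thesis"
  have subZ: "subgroup Z H" using Z(1) by (rule normal_imp_subgroup)
  have ZG: "z \<in> G" if "z \<in> Z" for z using subgroup.mem_carrier[OF subZ that] by simp
  have Zm: "x \<otimes>\<^bsub>H\<^esub> y \<in> Z" if "x \<in> Z" "y \<in> Z" for x y using subgroup.m_closed[OF subZ that] .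
  have Zc: "x (y v) = y (x v)" if "x \<in> Z" "y \<in> Z" "v \<in> V" for x y v
    using comm[OF that(1,2)] mult_apply[of x y v] mult_apply[of y x v] that ZG by metis
  have cube: "z (z (z v)) = v" if "z \<in> Z" "v \<in> V" for z v
    using pow_apply[OF ZG[OF that(1)] that(2), of 3] exp3[OF that(1)] that(2)
    by (simp add: numeral_3_eq_3)
  have ZV: "z v \<in> V" if "z \<in> Z" "v \<in> V" for z v using G_closed ZG that by blast
  have fp: "\<exists>v\<in>V. z v = v" if z: "z \<in> Z" for z
    using no semiregular_of_order_three[OF ZG[OF z] cube[OF z]] ZG[OF z] by blast
  have move: "z w \<noteq> w" if z: "z \<in> Z" "z \<noteq> \<one>\<^bsub>H\<^esub>" "z v = v" "v \<in> V" "w \<in> nb v" for z v w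
    using cube_fixing_arc[OF ZG[OF z(1)] exp3[OF z(1)] z(4,3,5)] z(2) by blast
  \<comment> \<open>By \<open>move\<close> a nontrivial element of \<open>Z\<close> fixing
    \<open>v\<close> fixes no neighbour of \<open>v\<close>, so it permutes the three in one
    cycle.\<close>
  have rot: "nb v = {w, z w, z (z w)}" if z: "z \<in> Z" "z \<noteq> \<one>\<^bsub>H\<^esub>" "z v = v" "v \<in> V" "w \<in> nb v" for z v w
  proof -
    have wV: "w \<in> V" using z(5) nb_V by blast
    have m: "z w \<in> nb v" "z (z w) \<in> nb v"
      using G_nb[OF ZG[OF z(1)] z(4)] z(3,5) by metis+
    have "z w \<noteq> w" "z (z w) \<noteq> z w" "z (z w) \<noteq> w"
      using move[OF z] move[OF z(1-4) m(1)] move[OF z(1-4) m(2)] cube[OF z(1) wV] by metis+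
    then have "card {w, z w, z (z w)} = 3" by simp
    then show ?thesis
      using card_nb[OF z(4)] card_seteq[OF finite_nb, of "{w, z w, z (z w)}" v] m z(5) by auto
  qed
  obtain a where a: "a \<in> Z" "a \<noteq> \<one>\<^bsub>H\<^esub>" using Z(2) subgroup.one_closed[OF subZ] by auto
  obtain v where v: "v \<in> V" "a v = v" using fp[OF a(1)] by auto
  have "nb v \<noteq> {}" using card_nb[OF v(1)] by auto
  then obtain w where w: "w \<in> nb v" by auto
  have wV: "w \<in> V" and vw: "v \<in> nb w" using w nb_V nb_sym by auto
  \<comment> \<open>If a nontrivial \<open>b\<close> fixed \<open>w\<close>, then
    \<open>nb w\<close> would be a \<open>b\<close>-orbit fixed pointwise by \<open>a\<close>, and
    \<open>nb v\<close> an \<open>a\<close>-orbit fixed pointwise by \<open>b\<close>. The graph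
    would be complete bipartite with these parts, and the product of \<open>a\<close> and
    \<open>b\<close> would move every vertex.\<close>
  have free: "b = \<one>\<^bsub>H\<^esub>" if b: "b \<in> Z" "b w = w" for b
  proof (rule ccontr)
    assume b1: "b \<noteq> \<one>\<^bsub>H\<^esub>"
    have nv: "nb v = {w, a w, a (a w)}" using rot[OF a v(2,1) w] .
    have nw: "nb w = {v, b v, b (b v)}" using rot[OF b(1) b1 b(2) wV vw] .
    have a_fix: "a u = u" if "u \<in> nb w" for u
      using that nw v Zc[OF a(1) b(1)] ZV[OF b(1)] by auto
    have b_fix: "b u = u" if "u \<in> nb v" for u
      using that nv b(2) wV Zc[OF b(1) a(1)] ZV[OF a(1)] by auto
    have nb1: "nb u = nb w" if "u \<in> nb v" for u
    proof -
      have aw: "nb (a u) = nb u" if "u \<in> V" "nb u = nb w" for u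
        using G_nb_image[OF ZG[OF a(1)] that(1)] that(2) a_fix by (simp add: image_cong[of _ _ a "\<lambda>x. x"])
      then show ?thesis using that nv wV ZV[OF a(1)] by auto
    qed
    have nb2: "nb u = nb v" if "u \<in> nb w" for u
    proof -
      have bv: "nb (b u) = nb u" if "u \<in> V" "nb u = nb v" for u
        using G_nb_image[OF ZG[OF b(1)] that(1)] that(2) b_fix by (simp add: image_cong[of _ _ b "\<lambda>x. x"])
      then show ?thesis using that nw v(1) ZV[OF b(1)] by auto
    qed
    have cover: "u \<in> nb v \<union> nb w" if "u \<in> V" for u
    proof (rule connected_induct[where v = v and P = "\<lambda>u. u \<in> nb v \<union> nb w"])
      fix u y assume "u \<in> nb v \<union> nb w" "y \<in> nb u"
      then show "y \<in> nb v \<union> nb w" using nb1[of u] nb2[of u] by blast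
    qed (use that v(1) vw in auto)
    let ?h = "a \<otimes>\<^bsub>H\<^esub> b"
    have "semiregular_element V ?h"
    proof (rule semiregular_of_order_three)
      show "?h \<in> G" using ZG Zm a b by blast
      show "?h (?h (?h u)) = u" if "u \<in> V" for u using cube[OF Zm[OF a(1) b(1)] that] .
      fix u assume u: "u \<in> V"
      have hu: "?h u = a (b u)" using u ZG a(1) b(1) by simp
      from cover[OF u] show "?h u \<noteq> u"
      proof
        assume "u \<in> nb v"
        then show ?thesis using hu b_fix move[OF a v(2,1)] by simp
      next
        assume uw: "u \<in> nb w"
        then have "b u \<in> nb w" using G_nb[OF ZG[OF b(1)] wV] b(2) by metis
        then show ?thesis using hu a_fix move[OF b(1) b1 b(2) wV uw] by simp
      qed
    qed
    then show False using no ZG Zm a b by blast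
  qed
  \<comment> \<open>Local transitivity at \<open>w\<close> and normality of \<open>Z\<close> carry
    the nontrivial stabiliser of \<open>v\<close> to every neighbour of \<open>w\<close>.\<close>
  have Zx: "\<exists>b\<in>Z. b \<noteq> \<one>\<^bsub>H\<^esub> \<and> b x = x" if x: "x \<in> nb w" for x
  proof -
    obtain g where g: "g \<in> G" "g w = w" "g v = x"
      using locally_transitive[of w v x] vw x by (auto simp: nb_def)
    let ?b = "g \<otimes>\<^bsub>H\<^esub> a \<otimes>\<^bsub>H\<^esub> inv\<^bsub>H\<^esub> g"
    have xV: "x \<in> V" using x nb_V by blast
    have "?b \<in> Z" using normal.inv_op_closed2[OF Z(1), of g a] g a by simp
    moreover have "?b x = x"
      using g(1,3) ZG[OF a(1)] v xV inv_apply(1)[OF g(1) v(1)] by simp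
    moreover have "?b \<noteq> \<one>\<^bsub>H\<^esub>"
    proof
      assume "?b = \<one>\<^bsub>H\<^esub>"
      then have "?b (g u) = g u" if "u \<in> V" for u using that G_closed[OF g(1)] by simp
      then have "g (a u) = g u" if "u \<in> V" for u
        using that g(1) ZG[OF a(1)] G_closed[OF g(1)] by simp
      then have "a u = \<one>\<^bsub>H\<^esub> u" if "u \<in> V" for u
        using that G_inj[OF g(1)] ZV[OF a(1)] by simp
      then show False using G_ext[OF ZG[OF a(1)] one_G] a(2) by blast
    qed
    ultimately show ?thesis by blast
  qed
  \<comment> \<open>The \<open>Z\<close>-orbits of \<open>w\<close> and of its neighbours form a set
    closed under adjacency: the neighbours of \<open>x\<close> in \<open>nb w\<close> are the images
    of \<open>w\<close> under powers of an element of \<open>Z\<close> fixing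
    \<open>x\<close>.\<close>
  have cover: "(\<exists>z\<in>Z. u = z w) \<or> (\<exists>z\<in>Z. \<exists>x\<in>nb w. u = z x)" if "u \<in> V" for u
  proof (rule connected_induct[where v = w and P = "\<lambda>u. (\<exists>z\<in>Z. u = z w) \<or> (\<exists>z\<in>Z. \<exists>x\<in>nb w. u = z x)"])
    have "\<one>\<^bsub>H\<^esub> \<in> Z" "w = \<one>\<^bsub>H\<^esub> w" using subgroup.one_closed[OF subZ] wV by auto
    then show "(\<exists>z\<in>Z. w = z w) \<or> (\<exists>z\<in>Z. \<exists>x\<in>nb w. w = z x)" by blast
    fix u y assume u: "u \<in> V" "(\<exists>z\<in>Z. u = z w) \<or> (\<exists>z\<in>Z. \<exists>x\<in>nb w. u = z x)" and y: "y \<in> nb u"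
    from u(2) show "(\<exists>z\<in>Z. y = z w) \<or> (\<exists>z\<in>Z. \<exists>x\<in>nb w. y = z x)"
    proof
      assume "\<exists>z\<in>Z. u = z w"
      then obtain z where z: "z \<in> Z" "u = z w" by auto
      then show ?thesis using G_nb_image[OF ZG[OF z(1)] wV] y by auto
    next
      assume "\<exists>z\<in>Z. \<exists>x\<in>nb w. u = z x"
      then obtain z x where z: "z \<in> Z" "x \<in> nb w" "u = z x" by auto
      obtain b where b: "b \<in> Z" "b \<noteq> \<one>\<^bsub>H\<^esub>" "b x = x" using Zx[OF z(2)] by auto
      have xV: "x \<in> V" using z nb_V by blast
      have nx: "nb x = {w, b w, b (b w)}" using rot[OF b xV] z(2) nb_sym by blast
      have "y \<in> z ` nb x" using G_nb_image[OF ZG[OF z(1)] xV] y z(3) by simp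
      then have "y = z w \<or> y = z (b w) \<or> y = z (b (b w))" using nx by auto
      moreover have "z (b w) = (z \<otimes>\<^bsub>H\<^esub> b) w" "z (b (b w)) = (z \<otimes>\<^bsub>H\<^esub> (b \<otimes>\<^bsub>H\<^esub> b)) w"
        using z b wV ZG Zm by simp_all
      ultimately show ?thesis using z(1) b(1) Zm by metis
    qed
  qed (use wV that in auto)
  \<comment> \<open>A vertex fixed by \<open>b\<close> is a \<open>Z\<close>-translate of
    \<open>w\<close> or of some \<open>x\<close> in \<open>nb w\<close>. By commutativity
    \<open>b\<close> fixes that representative, and \<open>free\<close> excludes
    \<open>w\<close>.\<close>
  have fix_x: "\<exists>x\<in>nb w. b x = x" if b: "b \<in> Z" "b \<noteq> \<one>\<^bsub>H\<^esub>" for b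
  proof -
    obtain u where u: "u \<in> V" "b u = u" using fp[OF b(1)] by auto
    from cover[OF u(1)] show ?thesis
    proof
      assume "\<exists>z\<in>Z. u = z w"
      then obtain z where z: "z \<in> Z" "u = z w" by auto
      then have "z (b w) = z w" using u Zc[OF b(1) z(1) wV] by simp
      then have "b w = w" using G_inj[OF ZG[OF z(1)]] wV ZV[OF b(1)] by simp
      then show ?thesis using free[OF b(1)] b(2) by simp
    next
      assume "\<exists>z\<in>Z. \<exists>x\<in>nb w. u = z x"
      then obtain z x where z: "z \<in> Z" "x \<in> nb w" "u = z x" by auto
      have xV: "x \<in> V" using z nb_V by blast
      have "z (b x) = z x" using u z Zc[OF b(1) z(1) xV] by simp
      then have "b x = x" using G_inj[OF ZG[OF z(1)]] xV ZV[OF b(1)] by simp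
      then show ?thesis using z by blast
    qed
  qed
  have fix_sq: "b x = x" if "b \<in> Z" "x \<in> V" "b (b x) = x" for b x
    using cube[OF that(1,2)] that(3) by simp
  \<comment> \<open>Otherwise choose a nontrivial \<open>b\<close> fixing \<open>y\<close>. Each of
    \<open>a\<close>, \<open>b\<close>, \<open>a b\<close> and \<open>a b b\<close> fixes a member
    of \<open>nb w\<close>. By \<open>clash\<close> no member is fixed by both \<open>a\<close> and
    \<open>b\<close>, so four different members would be needed, but there are only three.\<close>
  have a_fix: "a y = y" if y: "y \<in> nb w" for y
  proof (rule ccontr)
    assume ay: "a y \<noteq> y"
    have yV: "y \<in> V" using y nb_V by blast
    obtain b where b: "b \<in> Z" "b \<noteq> \<one>\<^bsub>H\<^esub>" "b y = y" using Zx[OF y] by auto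
    \<comment> \<open>If \<open>a\<close> and \<open>b\<close> both fix \<open>x\<close>, they
      rotate \<open>nb x\<close>, and \<open>a\<close> agrees at \<open>w\<close> with
      \<open>b\<close> or its square. By \<open>free\<close> it equals that element, which fixes
      \<open>y\<close> whereas \<open>a\<close> does not.\<close>
    have clash: False if x: "x \<in> nb w" "a x = x" "b x = x" for x
    proof -
      have xV: "x \<in> V" using x nb_V by blast
      have bb: "b \<otimes>\<^bsub>H\<^esub> b \<in> Z" using Zm b by blast
      have wx: "w \<in> nb x" using x nb_sym by blast
      have "a w \<in> nb x" using G_nb[OF ZG[OF a(1)] xV wx] x(2) by simp
      then have "a w = b w \<or> a w = b (b w)"
        using rot[OF b(1,2) x(3) xV wx] move[OF a x(2) xV wx] by auto
      moreover have "a = c" if c: "c \<in> Z" "a w = c w" for c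
      proof -
        have "(inv\<^bsub>H\<^esub> c \<otimes>\<^bsub>H\<^esub> a) w = w" using c a ZG wV inv_apply(1)[OF ZG[OF c(1)] wV] by simp
        then have "inv\<^bsub>H\<^esub> c \<otimes>\<^bsub>H\<^esub> a = \<one>\<^bsub>H\<^esub>"
          using free Zm subgroup.m_inv_closed[OF subZ c(1)] a by blast
        then have "c ((inv\<^bsub>H\<^esub> c) (a u)) = c u" if "u \<in> V" for u
          using mult_apply[of "inv\<^bsub>H\<^esub> c" a u] that ZG a c by simp
        then show ?thesis using G_ext[OF ZG[OF a(1)] ZG[OF c(1)]] ZG[OF c(1)] ZV[OF a(1)] by simp
      qed
      moreover have "b (b w) = (b \<otimes>\<^bsub>H\<^esub> b) w" using ZG b wV by simp
      ultimately have "a = b \<or> a = b \<otimes>\<^bsub>H\<^esub> b" using b(1) bb by metis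
      then show False using ay b yV ZG by auto
    qed
    have bv: "b v \<noteq> v" using clash[OF vw v(2)] by blast
    have ab: "a \<otimes>\<^bsub>H\<^esub> b \<in> Z" "a \<otimes>\<^bsub>H\<^esub> (b \<otimes>\<^bsub>H\<^esub> b) \<in> Z" using Zm a b by auto
    have abu: "(a \<otimes>\<^bsub>H\<^esub> b) u = a (b u)" "(a \<otimes>\<^bsub>H\<^esub> (b \<otimes>\<^bsub>H\<^esub> b)) u = a (b (b u))" if "u \<in> V" for u
      using that a b ZG by simp_all
    have ab_v: "a (b v) \<noteq> v" "a (b (b v)) \<noteq> v"
    proof -
      have "a (b v) = b v" "a (b (b v)) = b (b v)"
        using Zc[OF a(1) b(1)] v ZV[OF b(1)] by auto
      then show "a (b v) \<noteq> v" "a (b (b v)) \<noteq> v" using bv fix_sq[OF b(1) v(1)] by auto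
    qed
    have ab_y: "a (b y) \<noteq> y" "a (b (b y)) \<noteq> y" using b(3) ay by auto
    have "\<exists>x\<in>nb w. a (b x) = x"
      using fix_x[OF ab(1)] abu(1) ab_y(1) yV nb_V by (metis one_apply subsetD)
    then obtain x where x: "x \<in> nb w" "a (b x) = x" by auto
    have "\<exists>x\<in>nb w. a (b (b x)) = x"
      using fix_x[OF ab(2)] abu(2) ab_y(2) yV nb_V by (metis one_apply subsetD)
    then obtain x' where x': "x' \<in> nb w" "a (b (b x')) = x'" by auto
    have xV: "x \<in> V" using x nb_V by blast
    have "v \<noteq> y" using ay v by auto
    have "x \<noteq> v" "x \<noteq> y" "x' \<noteq> v" "x' \<noteq> y" using x x' ab_v ab_y by auto
    have "x' = x"
    proof (rule ccontr)
      assume "x' \<noteq> x"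
      then have "card {v, y, x, x'} = 4"
        using \<open>v \<noteq> y\<close> \<open>x \<noteq> v\<close> \<open>x \<noteq> y\<close> \<open>x' \<noteq> v\<close> \<open>x' \<noteq> y\<close> by auto
      moreover have "{v, y, x, x'} \<subseteq> nb w" using vw y x x' by auto
      ultimately show False using card_nb[OF wV] card_mono[OF finite_nb, of "{v, y, x, x'}" w] by simp
    qed
    then have x2: "a (b (b x)) = x" using x' by simp
    have "b x = x"
    proof -
      have "b (a (b x)) = a (b (b x))" using Zc[OF b(1) a(1)] ZV[OF b(1) xV] by simp
      then show ?thesis using x(2) x2 by simp
    qed
    moreover have "a x = x" using x(2) \<open>b x = x\<close> by simp
    ultimately show False using clash x by blast
  qed
  \<comment> \<open>The graph is now complete bipartite with parts \<open>nb w\<close> and the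
    \<open>a\<close>-orbit \<open>W\<close> of \<open>w\<close>; \<open>a\<close> fixes the first
    part pointwise and rotates the second.\<close>
  define W where "W = {w, a w, a (a w)}"
  have WV: "W \<subseteq> V" using wV ZV[OF a(1)] by (auto simp: W_def)
  have nbx: "nb x = W" if x: "x \<in> nb w" for x
    unfolding W_def using rot[OF a a_fix[OF x]] x nb_V nb_sym by blast
  have nb_a: "nb (a u) = nb w" if "u \<in> V" "nb u = nb w" for u
    using G_nb_image[OF ZG[OF a(1)] that(1)] that(2) a_fix by (simp add: image_cong[of _ _ a "\<lambda>x. x"])
  have nbW: "nb u = nb w" if "u \<in> W" for u
    using that nb_a wV ZV[OF a(1)] by (auto simp: W_def)
  have cover2: "u \<in> W \<union> nb w" if "u \<in> V" for u
  proof (rule connected_induct[where v = w and P = "\<lambda>u. u \<in> W \<union> nb w"])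
    fix u y assume "u \<in> W \<union> nb w" "y \<in> nb u"
    then show "y \<in> W \<union> nb w" using nbx[of u] nbW[of u] by blast
  qed (use that wV in \<open>auto simp: W_def\<close>)
  have aw: "a w \<noteq> w" using free[OF a(1)] a(2) by blast
  have a_move: "a u \<noteq> u" if "u \<in> W" for u
  proof
    assume au: "a u = u"
    have "w = u \<or> w = a u \<or> w = a (a u)"
      using that cube[OF a(1) wV] by (auto simp: W_def)
    then show False using au aw by auto
  qed
  obtain c where c: "c \<in> G" "c w = w" "\<And>x. x \<in> nb w \<Longrightarrow> c x \<noteq> x"
      "\<And>x. x \<in> nb w \<Longrightarrow> c (c (c x)) = x"
    using three_cycle_on_neighbours[OF wV] by blast
  have c_nb: "c x \<in> nb w" if "x \<in> nb w" for x using G_nb[OF c(1) wV that] c(2) by simp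
  have c_W: "c u \<in> W" if "u \<in> W" for u
  proof -
    have "u \<in> nb v" using that nbx[OF vw] by simp
    then have "c u \<in> nb (c v)" using G_nb[OF c(1) v(1)] by simp
    then show ?thesis using nbx[OF c_nb[OF vw]] by simp
  qed
  \<comment> \<open>Fixing \<open>w\<close>, \<open>c\<close> at most exchanges the other two
    vertices of \<open>W\<close>, so its square is trivial there.\<close>
  have c2: "c (c u) = u" if u: "u \<in> W" for u
  proof -
    have ne: "a w \<noteq> a (a w)" "a w \<noteq> w" "a (a w) \<noteq> w" using a_move[of w] a_move[of "a w"] fix_sq[OF a(1) wV]
      by (auto simp: W_def)
    have inj: "c p = c q \<longleftrightarrow> p = q" if "p \<in> W" "q \<in> W" for p q using that WV G_inj[OF c(1)] by blast
    have W: "w \<in> W" "a w \<in> W" "a (a w) \<in> W" by (auto simp: W_def)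
    have "c (a w) \<in> {a w, a (a w)}" "c (a (a w)) \<in> {a w, a (a w)}"
      using c_W[OF W(2)] c_W[OF W(3)] inj[OF W(2,1)] inj[OF W(3,1)] c(2) ne by (auto simp: W_def)
    moreover have "c (a w) \<noteq> c (a (a w))" using inj[OF W(2,3)] ne by simp
    ultimately show ?thesis using u c(2) by (auto simp: W_def)
  qed
  \<comment> \<open>The fourth power of \<open>c\<close> is trivial on \<open>W\<close>, where the
    square is, and equals \<open>c\<close> on \<open>nb w\<close>, where the cube is trivial. So
    \<open>s\<close> acts as \<open>a\<close> on \<open>W\<close> and as \<open>c\<close> on
    \<open>nb w\<close>, a 3-cycle on either part.\<close>
  define s where "s = a \<otimes>\<^bsub>H\<^esub> (c \<otimes>\<^bsub>H\<^esub> (c \<otimes>\<^bsub>H\<^esub> (c \<otimes>\<^bsub>H\<^esub> c)))"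
  have sG: "s \<in> G" using c ZG[OF a(1)] by (simp add: s_def)
  have s_apply: "s u = a (c (c (c (c u))))" if "u \<in> V" for u
    using that c(1) ZG[OF a(1)] G_closed[OF c(1)] by (simp add: s_def)
  have sW: "s u = a u" if "u \<in> W" for u using that s_apply c2 WV by auto
  have snb: "s x = c x" if "x \<in> nb w" for x
    using that s_apply nb_V c(4) c_nb a_fix by (simp add: subsetD[OF nb_V])
  have "semiregular_element V s"
  proof (rule semiregular_of_order_three[OF sG])
    fix u assume u: "u \<in> V"
    have aW: "a p \<in> W" if "p \<in> W" for p using that cube[OF a(1) wV] by (auto simp: W_def)
    from cover2[OF u] show "s (s (s u)) = u"
      using sW snb aW c_nb c(4) cube[OF a(1) u] by auto
    from cover2[OF u] show "s u \<noteq> u" using sW snb a_move c(3) by auto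
  qed
  then show False using no sG by blast
qed

section \<open>The case distinction on the prime divisors of the group order\<close>

lemma exists_semiregular: "\<exists>g\<in>G. semiregular_element V g"
proof (cases "\<exists>p. Factorial_Ring.prime p \<and> p dvd card G \<and> p > 3")
  case True
  then show ?thesis using semiregular_of_large_prime by blast
next
  case False
  have "p = 2 \<or> p = 3" if "Factorial_Ring.prime p" "p dvd card G" for p :: nat
    using False that prime_ge_2_nat[OF that(1)] by (cases "p > 3") auto
  moreover have "card G > 0" by (metis card_gt_0_iff empty_iff finG one_G)
  ultimately obtain m n where card: "card G = 2 ^ m * 3 ^ n"
    using two_three_power_if_prime_divisors by blast
  \<comment> \<open>Nontriviality, required for a nontrivial normal subgroup, comes from an element
    rotating the neighbours of a vertex.\<close>
  have "G \<noteq> {\<one>\<^bsub>H\<^esub>}"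
  proof
    assume G: "G = {\<one>\<^bsub>H\<^esub>}"
    obtain v where v: "v \<in> V" using conn by (auto simp: connected_graph_def)
    obtain c where c: "c \<in> G" "\<And>x. x \<in> nb v \<Longrightarrow> c x \<noteq> x"
      using three_cycle_on_neighbours[OF v] by blast
    have c1: "c = \<one>\<^bsub>H\<^esub>" using subsetD[OF equalityD1[OF G] c(1)] by (rule singletonD)
    obtain x where x: "x \<in> nb v" using card_nb[OF v] by fastforce
    then show False using c(2)[OF x] one_apply[OF subsetD[OF nb_V x]] unfolding c1 by blast
  qed
  then have "\<exists>p\<in>{2, 3}. \<exists>N k. N \<lhd> H \<and> N \<noteq> {\<one>\<^bsub>H\<^esub>} \<and> card N = p ^ k"
    using two_three_group_normal_p_subgroup[OF group_H, of m n] finG card by simp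
  then obtain p N k where N: "p = 2 \<or> p = 3" "N \<lhd> H" "N \<noteq> {\<one>\<^bsub>H\<^esub>}" "card N = p ^ k" by blast
  from N(1) show ?thesis
  proof
    assume "p = 2"
    then show ?thesis using semiregular_of_normal_two_subgroup N by blast
  next
    assume "p = 3"
    then obtain Z where Z: "Z \<lhd> H" "Z \<noteq> {\<one>\<^bsub>H\<^esub>}"
      "\<And>x y. x \<in> Z \<Longrightarrow> y \<in> Z \<Longrightarrow> x \<otimes>\<^bsub>H\<^esub> y = y \<otimes>\<^bsub>H\<^esub> x"
      "\<And>x. x \<in> Z \<Longrightarrow> x [^]\<^bsub>H\<^esub> (3::nat) = \<one>\<^bsub>H\<^esub>"
      using grp.normal_elementary_abelian_subgroup[of p N k] N finG by auto
    then show ?thesis by (rule semiregular_of_normal_elementary_abelian)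
  qed
qed

end

theorem theorem1p2:
  fixes V :: "'a set" and E :: "'a \<Rightarrow> 'a \<Rightarrow> bool" and G :: "('a \<Rightarrow> 'a) set"
  assumes "simple_graph V E" and "connected_graph V E" and "cubic V E"
    and "subgroup G (BijGroup V)" and "G \<subseteq> graph_aut V E"
    and "edge_transitive E G"
  shows "\<exists>g\<in>G. semiregular_element V g"
proof -
  interpret edge_transitive_cubic_graph V E G by (rule edge_transitive_cubic_graph.intro) (fact assms)+
  show ?thesis by (rule exists_semiregular)
qed

end
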